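(* Suppose there are $u_0>0$, $b_{\min}>0$, $\gamma\in\mathbb{R}$ with $|\Phi^\varepsilon(u)|\ge b_{\min}|u|^\gamma e^{-\beta|u|^s}$ for $|u|\ge u_0$, and $\Phi^\varepsilon(u)\neq0$ for all $u$. Let $\alpha_0>0$, $A>\alpha_0$, and let $f_n^{a}$ be the kernel estimator with bandwidth $$h_n^{a}=\left(\frac{\log n}{2\beta}-\frac{A}{\beta}\sqrt{\frac{\log n}{2\beta}}\right)^{-1/s}$$ (for $n$ large enough that $\log n/(2\beta)>(A/\beta)^2$). Then for $r=s/2$ and all $0<\alpha\le\alpha_0$, $L>0$, $$\limsup_{n\to\infty}\sup_{x\in\mathbb{R}}R_n(x,f_n^{a},\mathcal{A}_{\alpha,r}(L))\varphi_n^{-2}\le\exp\Big(\frac{\alpha A}{\beta}-\frac{\alpha^2}{\beta}\Big),\quad\limsup_{n\to\infty}R_n(\mathbb{L}_2,f_n^{a},\mathcal{A}_{\alpha,r}(L))\varphi_n^{-2}(\mathbb{L}_2)\le\exp\Big(\frac{\alpha A}{\beta}-\frac{\alpha^2}{\beta}\Big).$$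
   Context: Observations $Y_i=X_i+\varepsilon_i$, $i=1,\dots,n$, with $X_i$ i.i.d. with unknown density $f$, $\varepsilon_i$ i.i.d. with known density $f^\varepsilon$ and characteristic function $\Phi^\varepsilon$, independent of the $X_i$; $\beta>0$, $s>0$. $\Phi^g(u)=\int g(x)e^{ixu}dx$. $\mathcal{A}_{\alpha,r}(L)$ is the set of probability densities $f$ on $\mathbb{R}$ with $\int|\Phi^f(u)|^2e^{2\alpha|u|^r}du\le2\pi L$. Kernel estimator with bandwidth $h_n$: $\frac{1}{nh_n}\sum_{i=1}^nK_n\big(\frac{x-Y_i}{h_n}\big)$, $K_n$ the inverse Fourier transform of $I(|u|\le1)/\Phi^\varepsilon(u/h_n)$. Rates for $r=s/2$: $\varphi_n^2=\frac{L}{2\pi\alpha r}(\frac{\log n}{2\beta})^{(1-r)/s}\exp\big(-2\alpha\sqrt{\frac{\log n}{2\beta}}+\frac{\alpha^2}{\beta}\big)$ and $\varphi_n^2(\mathbb{L}_2)=L\exp\big(-2\alpha\sqrt{\frac{\log n}{2\beta}}+\frac{\alpha^2}{\beta}\big)$ (these are asymptotically equivalent to $\frac{L}{2\pi\alpha r}h_*^{r-1}e^{-2\alpha/h_*^r}$ and $Le^{-2\alpha/h_*^r}$, where $h_*$ solves $\frac{2\beta}{h_*^s}+\frac{2\alpha}{h_*^r}=\log n-(\log\log n)^2$). Risks: $R_n(x,T_n,\mathcal{A}_{\alpha,r}(L))=\sup_{f\in\mathcal{A}_{\alpha,r}(L)}E_f|T_n(x)-f(x)|^2$, $R_n(\m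athbb{L}_2,T_n,\mathcal{A}_{\alpha,r}(L))=\sup_{f\in\mathcal{A}_{\alpha,r}(L)}E_f\|T_n-f\|_2^2$.
   Formalization: Densities in the class A_{α,r}(L) are taken in their continuous version (each has exactly one); without fixing a version the value f(x), and so the pointwise risk, is not well defined, and altering f at one point would make it infinite. The L2 risk is unaffected. *)

theory Defs
  imports "HOL-Probability.Probability"
begin

definition is_density :: "(real \<Rightarrow> real) \<Rightarrow> bool" where
  "is_density g \<longleftrightarrow> g \<in> borel_measurable lborel \<and> (\<forall>x. 0 \<le> g x)
     \<and> (\<integral>\<^sup>+ x. ennreal (g x) \<partial>lborel) = 1"

definition Phi :: "(real \<Rightarrow> real) \<Rightarrow> real \<Rightarrow> complex" where
  "Phi g u = (LINT x|lborel. complex_of_real (g x) * cis (x * u))"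

text \<open>The class A_{alpha,r}(L); densities are taken in their continuous version
  (every member has an integrable Fourier transform, hence a continuous version),
  so that pointwise values f x are meaningful.\<close>
definition A_class :: "real \<Rightarrow> real \<Rightarrow> real \<Rightarrow> (real \<Rightarrow> real) set" where
  "A_class \<alpha> r L = {f. is_density f \<and> continuous_on UNIV f \<and>
     (\<integral>\<^sup>+ u. ennreal ((cmod (Phi f u))\<^sup>2 * exp (2 * \<alpha> * \<bar>u\<bar> powr r)) \<partial>lborel)
        \<le> ennreal (2 * pi * L)}"

definition decon_kernel :: "(real \<Rightarrow> complex) \<Rightarrow> real \<Rightarrow> real \<Rightarrow> complex" where
  "decon_kernel PhiE h z =
     (1 / (2 * pi)) * (LINT u:{-1..1}|lborel. cis (- (z * u)) / PhiE (u / h))"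

definition kernel_est :: "(real \<Rightarrow> complex) \<Rightarrow> nat \<Rightarrow> real \<Rightarrow> (nat \<Rightarrow> real) \<Rightarrow> real \<Rightarrow> complex" where
  "kernel_est PhiE n h Y x =
     (1 / (of_nat n * complex_of_real h)) * (\<Sum>i<n. decon_kernel PhiE h ((x - Y i) / h))"

definition sample_law :: "(real \<Rightarrow> real) \<Rightarrow> (real \<Rightarrow> real) \<Rightarrow> nat \<Rightarrow> (nat \<Rightarrow> real) measure" where
  "sample_law f feps n = PiM {..<n}
     (\<lambda>_. density lborel (\<lambda>x. ennreal (f x)) \<star> density lborel (\<lambda>x. ennreal (feps x)))"

definition risk_pt ::
  "(real \<Rightarrow> real) \<Rightarrow> (nat \<Rightarrow> real) \<Rightarrow> (real \<Rightarrow> real) set \<Rightarrow> nat \<Rightarrow> real \<Rightarrow> ennreal" where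
  "risk_pt feps h C n x = (SUP f\<in>C.
     \<integral>\<^sup>+ Y. ennreal ((cmod (kernel_est (Phi feps) n (h n) Y x - complex_of_real (f x)))\<^sup>2)
       \<partial>sample_law f feps n)"

definition risk_L2 ::
  "(real \<Rightarrow> real) \<Rightarrow> (nat \<Rightarrow> real) \<Rightarrow> (real \<Rightarrow> real) set \<Rightarrow> nat \<Rightarrow> ennreal" where
  "risk_L2 feps h C n = (SUP f\<in>C.
     \<integral>\<^sup>+ Y. (\<integral>\<^sup>+ x. ennreal ((cmod (kernel_est (Phi feps) n (h n) Y x - complex_of_real (f x)))\<^sup>2)
       \<partial>lborel) \<partial>sample_law f feps n)"

definition h_a :: "real \<Rightarrow> real \<Rightarrow> real \<Rightarrow> nat \<Rightarrow> real" where
  "h_a \<beta> s A n = (ln (real n) / (2 * \<beta>) - (A / \<beta>) * sqrt (ln (real n) / (2 * \<beta>))) powr (- 1 / s)"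

definition phi2 :: "real \<Rightarrow> real \<Rightarrow> real \<Rightarrow> real \<Rightarrow> real \<Rightarrow> nat \<Rightarrow> real" where
  "phi2 \<alpha> r L \<beta> s n = L / (2 * pi * \<alpha> * r) * (ln (real n) / (2 * \<beta>)) powr ((1 - r) / s)
     * exp (- 2 * \<alpha> * sqrt (ln (real n) / (2 * \<beta>)) + \<alpha>\<^sup>2 / \<beta>)"

definition phi2_L2 :: "real \<Rightarrow> real \<Rightarrow> real \<Rightarrow> nat \<Rightarrow> real" where
  "phi2_L2 \<alpha> L \<beta> n = L * exp (- 2 * \<alpha> * sqrt (ln (real n) / (2 * \<beta>)) + \<alpha>\<^sup>2 / \<beta>)"

end

theory Submission
  imports Defs "HOL-Real_Asymp.Real_Asymp"
begin

text \<open>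
  With \<open>a = 1 / h\<close> the estimator is an empirical mean of functions whose expectation is the
  Fourier inversion integral of \<open>f\<close> truncated to \<open>[-a, a]\<close>. The squared bias is therefore a tail of
  that integral: at a point, Cauchy--Schwarz against the weight \<open>exp (2 \<alpha> |u|\<^sup>r)\<close> bounds it by
  \<open>L / \<pi>\<close> times the integral of \<open>exp (-2 \<alpha> u\<^sup>r)\<close> over \<open>[a, \<infinity>)\<close>; in \<open>L\<^sub>2\<close>, Plancherel bounds it by
  \<open>L exp (-2 \<alpha> a\<^sup>r)\<close>. The variance is at most a power of \<open>a\<close> times \<open>exp (2 \<beta> a\<^sup>s) / n\<close>.
  Writing \<open>T = sqrt (ln n / (2 \<beta>))\<close>, the chosen bandwidth means \<open>a\<^sup>s = T\<^sup>2 - (A / \<beta>) T\<close>, so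
  \<open>exp (2 \<beta> a\<^sup>s) / n = exp (-2 A T)\<close>, which is negligible against \<open>exp (-2 \<alpha> T)\<close> because \<open>A > \<alpha>\<close>,
  whereas \<open>a\<^sup>r = T - A / (2 \<beta>) + o(1)\<close> produces the constant \<open>exp (\<alpha> A / \<beta> - \<alpha>\<^sup>2 / \<beta>)\<close>.
\<close>

section \<open>Plancherel's inequality and Fourier inversion\<close>

lemma cis_eq_iexp: "cis t = iexp t"
  by (simp add: cis_conv_exp)

lemma borel_measurable_cis [measurable]: "cis \<in> borel_measurable borel"
  by (intro borel_measurable_continuous_onI continuous_intros)

lemma borel_measurable_cnj [measurable]: "cnj \<in> borel_measurable borel"
  by (intro borel_measurable_continuous_onI continuous_intros)

text \<open>The characteristic function of the standard normal law is
  \<open>exp (- t\<^sup>2 / 2)\<close>, and rescaling the variable by \<sigma> gives a Gaussian in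
  \<open>d\<close>. It is written through \<open>normal_density 0 \<sigma>\<close> so that its total
  mass 1 can be used later.\<close>

lemma fourier_scaled_gaussian:
  assumes "\<sigma> > 0"
  shows "(LINT x|lborel. complex_of_real (std_normal_density (\<sigma> * x)) * cis (x * d))
    = complex_of_real (sqrt (2 * pi) * normal_density 0 \<sigma> d)"
proof -
  have "(LINT x|lborel. complex_of_real (std_normal_density x) * cis (x * (d / \<sigma>)))
      = char std_normal_distribution (d / \<sigma>)"
    unfolding char_def
    by (subst integral_density) (auto simp: cis_eq_iexp scaleR_conv_of_real mult.commute)
  also have "\<dots> = complex_of_real (exp (- ((d / \<sigma>)\<^sup>2) / 2))"
    by (simp only: char_std_normal_distribution)
  finally have std: "(LINT x|lborel. complex_of_real (std_normal_density x) * cis (x * (d / \<sigma>)))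
      = complex_of_real (exp (- ((d / \<sigma>)\<^sup>2) / 2))" .
  have "(LINT x|lborel. complex_of_real (std_normal_density x) * cis (x * (d / \<sigma>)))
      = \<sigma> *\<^sub>R (LINT x|lborel. complex_of_real (std_normal_density (\<sigma> * x)) * cis (x * d))"
    using lborel_integral_real_affine[of \<sigma>
        "\<lambda>x. complex_of_real (std_normal_density x) * cis (x * (d / \<sigma>))" 0] assms
    by simp
  with std assms have "(LINT x|lborel. complex_of_real (std_normal_density (\<sigma> * x)) * cis (x * d))
      = complex_of_real (exp (- ((d / \<sigma>)\<^sup>2) / 2) / \<sigma>)"
    by (simp add: scaleR_conv_of_real field_simps)
  also have "exp (- ((d / \<sigma>)\<^sup>2) / 2) / \<sigma> = sqrt (2 * pi) * normal_density 0 \<sigma> d"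
    using assms by (simp add: normal_density_def real_sqrt_mult power_divide)
  finally show ?thesis .
qed

lemma nn_integral_normal_density_shift:
  assumes "\<sigma> > 0"
  shows "(\<integral>\<^sup>+ w. ennreal (normal_density 0 \<sigma> (v - w)) \<partial>lborel) = 1"
    and "(\<integral>\<^sup>+ w. ennreal (normal_density 0 \<sigma> (w - v)) \<partial>lborel) = 1"
proof -
  have 1: "(\<integral>\<^sup>+ w. ennreal (normal_density 0 \<sigma> w) \<partial>lborel) = 1"
    using assms by (subst nn_integral_eq_integral) auto
  show "(\<integral>\<^sup>+ w. ennreal (normal_density 0 \<sigma> (v - w)) \<partial>lborel) = 1"
    using 1 by (subst (asm) nn_integral_real_affine[where c="-1" and t=v]) auto
  show "(\<integral>\<^sup>+ w. ennreal (normal_density 0 \<sigma> (w - v)) \<partial>lborel) = 1"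
    using 1 by (subst (asm) nn_integral_real_affine[where c="1" and t="-v"]) auto
qed

lemma std_normal_density_le: "std_normal_density x \<le> 1 / sqrt (2 * pi)"
  by (simp add: std_normal_density_def divide_right_mono)

lemma integrable_std_normal_density_scaled:
  "\<sigma> > 0 \<Longrightarrow> integrable lborel (\<lambda>x. std_normal_density (\<sigma> * x))"
  using lborel_integrable_real_affine[OF integrable_normal_density[OF zero_less_one], of \<sigma> 0 0] by simp

text \<open>Expand \<open>(cmod (G x))\<^sup>2\<close> as a double integral of
  \<open>g v * cnj (g w)\<close> against \<open>cis (- (x * (v - w)))\<close>. The Gaussian weight
  makes the triple integral absolutely convergent, so \<open>x\<close> can be integrated first,
  leaving a normal density in \<open>v - w\<close>. The inequality |g v| |g w| \<le> (|g v|^2 + |g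
  w|^2) / 2 and the mass 1 of that density give a bound that does not depend on \<sigma>.\<close>

lemma bessel_gaussian_weight:
  fixes g :: "real \<Rightarrow> complex"
  assumes int: "integrable lborel g" and \<sigma>: "\<sigma> > 0"
  defines "G \<equiv> \<lambda>x. LINT v|lborel. g v * cis (- (x * v))"
  shows "(\<integral>\<^sup>+ x. ennreal (std_normal_density (\<sigma> * x) * (cmod (G x))\<^sup>2) \<partial>lborel)
    \<le> ennreal (sqrt (2 * pi)) * (\<integral>\<^sup>+ v. ennreal ((cmod (g v))\<^sup>2) \<partial>lborel)"
proof -
  interpret xp: pair_sigma_finite "lborel :: real measure" "lborel \<Otimes>\<^sub>M (lborel :: real measure)" ..
  have [measurable]: "g \<in> borel_measurable lborel" using int by auto
  define H where "H = (\<lambda>p. g (fst p) * cnj (g (snd p)))"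
  have [measurable]: "H \<in> borel_measurable (lborel \<Otimes>\<^sub>M lborel)" unfolding H_def by measurable
  have Gm[measurable]: "G \<in> borel_measurable borel" unfolding G_def by measurable
  have intH: "integrable (lborel \<Otimes>\<^sub>M lborel) (\<lambda>p. H p * cis (- (x * (fst p - snd p))))" for x
  proof -
    have "integrable (lborel \<Otimes>\<^sub>M lborel) (\<lambda>p. case p of (v, w) \<Rightarrow> H (v, w))"
    proof (rule lborel_pair.Fubini_integrable)
      have "integrable lborel (\<lambda>v. cmod (g v) * (LINT w|lborel. cmod (g w)))"
        using int by auto
      then show "integrable lborel (\<lambda>v. LINT w|lborel. cmod (case (v, w) of (v, w) \<Rightarrow> H (v, w)))"
        by (simp add: H_def norm_mult)
      show "AE v in lborel. integrable lborel (\<lambda>w. case (v, w) of (v, w) \<Rightarrow> H (v, w))"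
        using int by (auto simp: H_def)
    qed auto
    then have "integrable (lborel \<Otimes>\<^sub>M lborel) H" by simp
    then show ?thesis
      by (rule Bochner_Integration.integrable_bound) (auto simp: norm_mult)
  qed
  have sq: "complex_of_real ((cmod (G x))\<^sup>2) = (LINT p|(lborel \<Otimes>\<^sub>M lborel). H p * cis (- (x * (fst p - snd p))))" for x
  proof -
    have "complex_of_real ((cmod (G x))\<^sup>2) = G x * cnj (G x)"
      by (rule complex_norm_square)
    also have "cnj (G x) = (LINT w|lborel. cnj (g w) * cis (x * w))"
      unfolding G_def by (subst Bochner_Integration.integral_cnj[symmetric]) (simp add: cis_cnj)
    also have "G x * \<dots> = (LINT v|lborel. LINT w|lborel. (g v * cis (- (x * v))) * (cnj (g w) * cis (x * w)))"
      unfolding G_def by simp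
    also have "\<dots> = (LINT v|lborel. LINT w|lborel. H (v, w) * cis (- (x * (fst (v, w) - snd (v, w)))))"
      by (intro Bochner_Integration.integral_cong refl)
         (simp add: H_def algebra_simps cis_mult cis_divide)
    also have "\<dots> = (LINT p|(lborel \<Otimes>\<^sub>M lborel). H p * cis (- (x * (fst p - snd p))))"
      by (rule lborel_pair.integral_fst'[OF intH])
    finally show ?thesis .
  qed
  have intH0: "integrable (lborel \<Otimes>\<^sub>M lborel) H"
    using intH[of 0] by simp
  define J where "J = (\<lambda>x p. complex_of_real (std_normal_density (\<sigma> * x)) * (H p * cis (- (x * (fst p - snd p)))))"
  have intJ: "integrable (lborel \<Otimes>\<^sub>M (lborel \<Otimes>\<^sub>M lborel)) (\<lambda>(x, p). J x p)"
  proof (rule xp.Fubini_integrable)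
    show "(\<lambda>(x, p). J x p) \<in> borel_measurable (lborel \<Otimes>\<^sub>M (lborel \<Otimes>\<^sub>M lborel))"
      unfolding J_def by measurable
    have "integrable lborel (\<lambda>x. std_normal_density (\<sigma> * x) * (LINT p|(lborel \<Otimes>\<^sub>M lborel). cmod (H p)))"
      using integrable_std_normal_density_scaled[OF \<sigma>] by auto
    then show "integrable lborel (\<lambda>x. LINT p|(lborel \<Otimes>\<^sub>M lborel). cmod (case (x, p) of (x, p) \<Rightarrow> J x p))"
      by (simp add: J_def norm_mult)
    show "AE x in lborel. integrable (lborel \<Otimes>\<^sub>M lborel) (\<lambda>p. case (x, p) of (x, p) \<Rightarrow> J x p)"
      using intH by (simp add: J_def)
  qed
  have JG: "(LINT p|(lborel \<Otimes>\<^sub>M lborel). J x p) = complex_of_real (std_normal_density (\<sigma> * x) * (cmod (G x))\<^sup>2)" for x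
    unfolding J_def by (simp add: sq[symmetric])
  have "integrable lborel (\<lambda>x. LINT p|(lborel \<Otimes>\<^sub>M lborel). J x p)"
    using xp.integrable_fst'[OF intJ] by simp
  then have iG: "integrable lborel (\<lambda>x. complex_of_real (std_normal_density (\<sigma> * x) * (cmod (G x))\<^sup>2))"
    unfolding JG .
  have iG': "integrable lborel (\<lambda>x. std_normal_density (\<sigma> * x) * (cmod (G x))\<^sup>2)"
    using iG unfolding complex_of_real_integrable_eq .
  have "complex_of_real (LINT x|lborel. std_normal_density (\<sigma> * x) * (cmod (G x))\<^sup>2)
     = (LINT x|lborel. LINT p|(lborel \<Otimes>\<^sub>M lborel). J x p)"
    unfolding JG by (rule integral_complex_of_real[symmetric])
  also have "\<dots> = (LINT p|(lborel \<Otimes>\<^sub>M lborel). LINT x|lborel. J x p)"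
    by (rule xp.Fubini_integral[OF intJ, symmetric])
  also have "\<dots> = (LINT p|(lborel \<Otimes>\<^sub>M lborel). H p * complex_of_real (sqrt (2 * pi) * normal_density 0 \<sigma> (fst p - snd p)))"
  proof (rule Bochner_Integration.integral_cong[OF refl])
    fix p :: "real \<times> real"
    have "(LINT x|lborel. J x p) = (LINT x|lborel. H p * (complex_of_real (std_normal_density (\<sigma> * x)) * cis (x * (- (fst p - snd p)))))"
      unfolding J_def by (intro Bochner_Integration.integral_cong refl) (simp add: algebra_simps)
    also have "\<dots> = H p * (LINT x|lborel. complex_of_real (std_normal_density (\<sigma> * x)) * cis (x * (- (fst p - snd p))))"
      by simp
    also have "\<dots> = H p * complex_of_real (sqrt (2 * pi) * normal_density 0 \<sigma> (fst p - snd p))"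
      by (subst fourier_scaled_gaussian[OF \<sigma>]) (simp add: normal_density_def power2_commute)
    finally show "(LINT x|lborel. J x p) = \<dots>" .
  qed
  finally have eq: "complex_of_real (LINT x|lborel. std_normal_density (\<sigma> * x) * (cmod (G x))\<^sup>2) = \<dots>" .
  have "(\<integral>\<^sup>+ x. ennreal (std_normal_density (\<sigma> * x) * (cmod (G x))\<^sup>2) \<partial>lborel)
      = ennreal (LINT x|lborel. std_normal_density (\<sigma> * x) * (cmod (G x))\<^sup>2)"
    by (rule nn_integral_eq_integral[OF iG']) simp
  also have "(LINT x|lborel. std_normal_density (\<sigma> * x) * (cmod (G x))\<^sup>2)
      = cmod (complex_of_real (LINT x|lborel. std_normal_density (\<sigma> * x) * (cmod (G x))\<^sup>2))"
    by (simp only: norm_of_real) (simp add: integral_nonneg_AE)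
  also have "ennreal \<dots> \<le> (\<integral>\<^sup>+ p. ennreal (cmod (H p * complex_of_real (sqrt (2 * pi) * normal_density 0 \<sigma> (fst p - snd p)))) \<partial>(lborel \<Otimes>\<^sub>M lborel))"
    unfolding eq
  proof (rule integral_norm_bound_ennreal)
    show "integrable (lborel \<Otimes>\<^sub>M lborel) (\<lambda>p. H p * complex_of_real (sqrt (2 * pi) * normal_density 0 \<sigma> (fst p - snd p)))"
    proof (rule Bochner_Integration.integrable_bound)
      \<comment> \<open>The factor \<open>sqrt (2 * pi) * normal_density 0 \<sigma>\<close> never
        exceeds its peak value 1 / \<sigma>.\<close>
      show "integrable (lborel \<Otimes>\<^sub>M lborel) (\<lambda>p. H p * complex_of_real (1 / \<sigma>))"
        using intH0 by auto
      show "AE p in lborel \<Otimes>\<^sub>M lborel. cmod (H p * complex_of_real (sqrt (2 * pi) * normal_density 0 \<sigma> (fst p - snd p)))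
          \<le> cmod (H p * complex_of_real (1 / \<sigma>))"
        using \<sigma> by (intro AE_I2) (auto simp: norm_mult normal_density_def real_sqrt_mult norm_divide
            intro!: mult_left_le divide_right_mono)
    qed measurable
  qed
  also have "\<dots> \<le> (\<integral>\<^sup>+ p. ennreal (sqrt (2 * pi)) * (ennreal (1/2) * (ennreal ((cmod (g (fst p)))\<^sup>2) * ennreal (normal_density 0 \<sigma> (fst p - snd p))
      + ennreal ((cmod (g (snd p)))\<^sup>2) * ennreal (normal_density 0 \<sigma> (fst p - snd p)))) \<partial>(lborel \<Otimes>\<^sub>M lborel))"
  proof (rule nn_integral_mono)
    fix p :: "real \<times> real"
    let ?a = "cmod (g (fst p))" and ?b = "cmod (g (snd p))" and ?N = "normal_density 0 \<sigma> (fst p - snd p)"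
    have "?a * ?b \<le> 1/2 * (?a\<^sup>2 + ?b\<^sup>2)"
      using sum_squares_bound[of ?a ?b] by simp
    then have "(?a * ?b) * (sqrt (2 * pi) * ?N) \<le> (1/2 * (?a\<^sup>2 + ?b\<^sup>2)) * (sqrt (2 * pi) * ?N)"
      by (intro mult_right_mono) auto
    then have "cmod (H p * complex_of_real (sqrt (2 * pi) * ?N)) \<le> sqrt (2 * pi) * (1/2 * (?a\<^sup>2 * ?N + ?b\<^sup>2 * ?N))"
      by (simp add: H_def norm_mult algebra_simps)
    then have "ennreal (cmod (H p * complex_of_real (sqrt (2 * pi) * ?N))) \<le> ennreal (sqrt (2 * pi) * (1/2 * (?a\<^sup>2 * ?N + ?b\<^sup>2 * ?N)))"
      by (rule ennreal_leI)
    also have "\<dots> = ennreal (sqrt (2 * pi)) * (ennreal (1/2) * (ennreal (?a\<^sup>2) * ennreal ?N + ennreal (?b\<^sup>2) * ennreal ?N))"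
      by (simp only: ennreal_mult ennreal_plus normal_density_nonneg zero_le_power2 mult_nonneg_nonneg real_sqrt_ge_zero
          add_nonneg_nonneg pi_ge_zero zero_le_numeral zero_le_one divide_nonneg_nonneg)
    finally show "ennreal (cmod (H p * complex_of_real (sqrt (2 * pi) * ?N))) \<le> \<dots>" .
  qed
  also have "\<dots> = ennreal (sqrt (2 * pi)) * (ennreal (1/2) *
      ((\<integral>\<^sup>+ p. ennreal ((cmod (g (fst p)))\<^sup>2) * ennreal (normal_density 0 \<sigma> (fst p - snd p)) \<partial>(lborel \<Otimes>\<^sub>M lborel))
      + (\<integral>\<^sup>+ p. ennreal ((cmod (g (snd p)))\<^sup>2) * ennreal (normal_density 0 \<sigma> (fst p - snd p)) \<partial>(lborel \<Otimes>\<^sub>M lborel))))"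
    by (subst nn_integral_cmult, measurable, subst nn_integral_cmult, measurable, subst nn_integral_add, measurable)
  also have "(\<integral>\<^sup>+ p. ennreal ((cmod (g (fst p)))\<^sup>2) * ennreal (normal_density 0 \<sigma> (fst p - snd p)) \<partial>(lborel \<Otimes>\<^sub>M lborel))
      = (\<integral>\<^sup>+ v. \<integral>\<^sup>+ w. ennreal ((cmod (g v))\<^sup>2) * ennreal (normal_density 0 \<sigma> (v - w)) \<partial>lborel \<partial>lborel)"
    by (subst lborel.nn_integral_fst[symmetric]) auto
  also have "\<dots> = (\<integral>\<^sup>+ v. ennreal ((cmod (g v))\<^sup>2) \<partial>lborel)"
    by (subst nn_integral_cmult) (auto simp: nn_integral_normal_density_shift[OF \<sigma>])
  also have "(\<integral>\<^sup>+ p. ennreal ((cmod (g (snd p)))\<^sup>2) * ennreal (normal_density 0 \<sigma> (fst p - snd p)) \<partial>(lborel \<Otimes>\<^sub>M lborel))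
      = (\<integral>\<^sup>+ w. \<integral>\<^sup>+ v. ennreal ((cmod (g w))\<^sup>2) * ennreal (normal_density 0 \<sigma> (v - w)) \<partial>lborel \<partial>lborel)"
    by (subst lborel_pair.nn_integral_snd[symmetric]) auto
  also have "\<dots> = (\<integral>\<^sup>+ v. ennreal ((cmod (g v))\<^sup>2) \<partial>lborel)"
    by (subst nn_integral_cmult) (auto simp: nn_integral_normal_density_shift[OF \<sigma>])
  also have "ennreal (1/2) * ((\<integral>\<^sup>+ v. ennreal ((cmod (g v))\<^sup>2) \<partial>lborel) + (\<integral>\<^sup>+ v. ennreal ((cmod (g v))\<^sup>2) \<partial>lborel))
      = (\<integral>\<^sup>+ v. ennreal ((cmod (g v))\<^sup>2) \<partial>lborel)"
  proof -
    have "ennreal (1/2) * 2 = 1"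
      using ennreal_mult[of "1/2" 2] by simp
    then have "ennreal (1/2) * (I + I) = I" for I
      by (metis mult.assoc mult_1 mult_2)
    then show ?thesis .
  qed
  finally show ?thesis .
qed

lemma tendsto_std_normal_density_scaled:
  "(\<lambda>k. std_normal_density (inverse (real (Suc k)) * x)) \<longlonglongrightarrow> 1 / sqrt (2 * pi)"
proof -
  have "(\<lambda>k. 1 / sqrt (2 * pi) * exp (- (inverse (real (Suc k)) * x)\<^sup>2 / 2))
      \<longlonglongrightarrow> 1 / sqrt (2 * pi) * exp (- (0 * x)\<^sup>2 / 2)"
    by (intro tendsto_intros LIMSEQ_inverse_real_of_nat) auto
  then show ?thesis
    by (simp add: std_normal_density_def)
qed

text \<open>As the Gaussian weight flattens it tends to the constant
  \<open>1 / sqrt (2 * pi)\<close>. The weighted bound is uniform in the width, so Fatou's lemma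
  carries it to the limit. Only this direction of Plancherel enters the upper bounds on the
  risks.\<close>

lemma plancherel_le:
  fixes g :: "real \<Rightarrow> complex"
  assumes int: "integrable lborel g"
  shows "(\<integral>\<^sup>+ x. ennreal ((cmod (LINT v|lborel. g v * cis (- (x * v))))\<^sup>2) \<partial>lborel)
    \<le> ennreal (2 * pi) * (\<integral>\<^sup>+ v. ennreal ((cmod (g v))\<^sup>2) \<partial>lborel)"
proof -
  have [measurable]: "g \<in> borel_measurable lborel" using int by auto
  define G where "G = (\<lambda>x. LINT v|lborel. g v * cis (- (x * v)))"
  have [measurable]: "G \<in> borel_measurable borel" unfolding G_def by measurable
  let ?w = "\<lambda>k x. std_normal_density (inverse (real (Suc k)) * x)"
  let ?I = "\<integral>\<^sup>+ v. ennreal ((cmod (g v))\<^sup>2) \<partial>lborel"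
  have "ennreal (1 / sqrt (2 * pi)) * (\<integral>\<^sup>+ x. ennreal ((cmod (G x))\<^sup>2) \<partial>lborel)
      = (\<integral>\<^sup>+ x. ennreal (1 / sqrt (2 * pi) * (cmod (G x))\<^sup>2) \<partial>lborel)"
    by (subst nn_integral_cmult[symmetric]) (auto simp: ennreal_mult[symmetric])
  also have "\<dots> = (\<integral>\<^sup>+ x. liminf (\<lambda>k. ennreal (?w k x * (cmod (G x))\<^sup>2)) \<partial>lborel)"
  proof (rule nn_integral_cong)
    fix x
    have "(\<lambda>k. ennreal (?w k x * (cmod (G x))\<^sup>2)) \<longlonglongrightarrow> ennreal (1 / sqrt (2 * pi) * (cmod (G x))\<^sup>2)"
      by (intro tendsto_ennrealI tendsto_mult tendsto_std_normal_density_scaled tendsto_const)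
    then show "ennreal (1 / sqrt (2 * pi) * (cmod (G x))\<^sup>2) = liminf (\<lambda>k. ennreal (?w k x * (cmod (G x))\<^sup>2))"
      by (intro lim_imp_Liminf[symmetric]) auto
  qed
  also have "\<dots> \<le> liminf (\<lambda>k. \<integral>\<^sup>+ x. ennreal (?w k x * (cmod (G x))\<^sup>2) \<partial>lborel)"
    by (rule nn_integral_liminf) measurable
  also have "\<dots> \<le> limsup (\<lambda>k. \<integral>\<^sup>+ x. ennreal (?w k x * (cmod (G x))\<^sup>2) \<partial>lborel)"
    by (rule Liminf_le_Limsup) simp
  also have "\<dots> \<le> ennreal (sqrt (2 * pi)) * ?I"
    using bessel_gaussian_weight[OF int]
    by (intro Limsup_bounded always_eventually) (auto simp: G_def)
  finally have "ennreal (sqrt (2 * pi)) * (ennreal (1 / sqrt (2 * pi)) * (\<integral>\<^sup>+ x. ennreal ((cmod (G x))\<^sup>2) \<partial>lborel))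
      \<le> ennreal (sqrt (2 * pi)) * (ennreal (sqrt (2 * pi)) * ?I)"
    by (rule mult_left_mono) simp
  then show ?thesis
    by (simp add: mult.assoc[symmetric] ennreal_mult[symmetric] G_def)
qed

section \<open>Characteristic functions of densities and Gaussian smoothing\<close>

lemma is_densityD:
  assumes "is_density f"
  shows "f \<in> borel_measurable borel" "\<And>x. 0 \<le> f x" "integrable lborel f"
    "real_distribution (density lborel (\<lambda>x. ennreal (f x)))"
proof -
  show m[measurable]: "f \<in> borel_measurable borel" and nn: "\<And>x. 0 \<le> f x"
    using assms by (auto simp: is_density_def)
  show "integrable lborel f"
    using assms by (intro integrableI_nonneg) (auto simp: is_density_def)
  have "prob_space (density lborel (\<lambda>x. ennreal (f x)))"
    using assms by (intro prob_spaceI) (simp add: emeasure_density is_density_def)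
  then show "real_distribution (density lborel (\<lambda>x. ennreal (f x)))"
    by (simp add: real_distribution_def real_distribution_axioms_def)
qed

lemma Phi_eq_char:
  assumes "is_density f"
  shows "Phi f = char (density lborel (\<lambda>x. ennreal (f x)))"
proof
  fix u
  show "Phi f u = char (density lborel (\<lambda>x. ennreal (f x))) u"
    using is_densityD[OF assms] unfolding Phi_def char_def
    by (subst integral_density)
       (auto simp: cis_eq_iexp scaleR_conv_of_real mult.commute)
qed

lemma continuous_on_Phi:
  assumes "is_density f"
  shows "continuous_on A (Phi f)"
proof -
  interpret real_distribution "density lborel (\<lambda>x. ennreal (f x))"
    using is_densityD[OF assms] by simp
  show ?thesis
    unfolding Phi_eq_char[OF assms] using isCont_char by (simp add: continuous_at_imp_continuous_on)
qed

lemma borel_measurable_Phi: "is_density f \<Longrightarrow> Phi f \<in> borel_measurable borel"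
  by (intro borel_measurable_continuous_onI continuous_on_Phi)

text \<open>The left side averages \<open>f\<close> around \<open>x\<close> with Gaussian noise of
  size \<sigma>. Writing the Gaussian as a Fourier integral and exchanging the integrals turns it
  into the inversion integral damped by a Gaussian weight, which converges whether or not
  \<open>Phi f\<close> is integrable.\<close>

lemma convolution_gaussian_eq:
  assumes f: "is_density f" and \<sigma>: "\<sigma> > 0"
  shows "complex_of_real (LINT z|lborel. f (x - \<sigma> * z) * std_normal_density z)
    = complex_of_real (1 / sqrt (2 * pi)) * (LINT v|lborel. complex_of_real (std_normal_density (\<sigma> * v)) * (Phi f v * cis (- (x * v))))"
proof -
  note [measurable] = is_densityD(1)[OF f]
  have fi: "integrable lborel f" and fn: "\<And>x. 0 \<le> f x" using is_densityD[OF f] by auto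
  let ?h = "\<lambda>y v. complex_of_real (f y * std_normal_density (\<sigma> * v)) * cis (v * (y - x))"
  have int: "integrable (lborel \<Otimes>\<^sub>M lborel) (\<lambda>(y, v). ?h y v)"
  proof (rule lborel_pair.Fubini_integrable)
    have "integrable lborel (\<lambda>y. f y * (LINT v|lborel. std_normal_density (\<sigma> * v)))"
      using fi by auto
    then show "integrable lborel (\<lambda>y. LINT v|lborel. cmod (case (y, v) of (y, v) \<Rightarrow> ?h y v))"
      using fn by (simp add: norm_mult)
    have "integrable lborel (\<lambda>v. ?h y v)" for y
    proof (rule Bochner_Integration.integrable_bound)
      show "integrable lborel (\<lambda>v. f y * std_normal_density (\<sigma> * v))"
        using integrable_std_normal_density_scaled[OF \<sigma>] by auto
    qed (auto simp: norm_mult)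
    then show "AE y in lborel. integrable lborel (\<lambda>v. case (y, v) of (y, v) \<Rightarrow> ?h y v)"
      by simp
  qed measurable
  \<comment> \<open>The substitution is y = x - \<sigma> z; the Jacobian \<sigma> is absorbed by the
    scaling of the normal density.\<close>
  have "(LINT z|lborel. f (x - \<sigma> * z) * std_normal_density z) = (LINT y|lborel. f y * normal_density 0 \<sigma> (y - x))"
  proof -
    have eq: "\<sigma> * normal_density 0 \<sigma> (- (\<sigma> * z)) = std_normal_density z" for z
      using \<sigma> by (simp add: normal_density_def real_sqrt_mult power_mult_distrib)
    have "(LINT y|lborel. f y * normal_density 0 \<sigma> (y - x))
       = \<sigma> * (LINT z|lborel. f (x - \<sigma> * z) * normal_density 0 \<sigma> (- (\<sigma> * z)))"
      using lborel_integral_real_affine[of "- \<sigma>" "\<lambda>y. f y * normal_density 0 \<sigma> (y - x)" x] \<sigma> by simp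
    also have "\<dots> = (LINT z|lborel. f (x - \<sigma> * z) * (\<sigma> * normal_density 0 \<sigma> (- (\<sigma> * z))))"
      by (subst integral_mult_right_zero[symmetric]) (simp add: mult.left_commute)
    finally show ?thesis
      unfolding eq by simp
  qed
  then have "complex_of_real (LINT z|lborel. f (x - \<sigma> * z) * std_normal_density z)
      = (LINT y|lborel. complex_of_real (f y * normal_density 0 \<sigma> (y - x)))"
    by (simp only: integral_complex_of_real)
  also have "\<dots> = (LINT y|lborel. complex_of_real (1 / sqrt (2 * pi)) * (LINT v|lborel. ?h y v))"
  proof (rule Bochner_Integration.integral_cong[OF refl])
    fix y
    have "(LINT v|lborel. ?h y v) = complex_of_real (f y) * (LINT v|lborel. complex_of_real (std_normal_density (\<sigma> * v)) * cis (v * (y - x)))"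
      by (subst integral_mult_right_zero[symmetric]) (simp add: mult.assoc)
    also have "\<dots> = complex_of_real (f y * (sqrt (2 * pi) * normal_density 0 \<sigma> (y - x)))"
      by (subst fourier_scaled_gaussian[OF \<sigma>]) simp
    finally show "complex_of_real (f y * normal_density 0 \<sigma> (y - x)) = complex_of_real (1 / sqrt (2 * pi)) * (LINT v|lborel. ?h y v)"
      by simp
  qed
  also have "\<dots> = complex_of_real (1 / sqrt (2 * pi)) * (LINT y|lborel. LINT v|lborel. ?h y v)"
    by (rule integral_mult_right_zero)
  also have "(LINT y|lborel. LINT v|lborel. ?h y v) = (LINT v|lborel. LINT y|lborel. ?h y v)"
    by (rule lborel_pair.Fubini_integral[OF int, symmetric])
  also have "\<dots> = (LINT v|lborel. complex_of_real (std_normal_density (\<sigma> * v)) * (Phi f v * cis (- (x * v))))"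
  proof (rule Bochner_Integration.integral_cong[OF refl])
    fix v
    have "(LINT y|lborel. ?h y v) = (LINT y|lborel. (complex_of_real (std_normal_density (\<sigma> * v)) * cis (- (x * v))) * (complex_of_real (f y) * cis (y * v)))"
      by (intro Bochner_Integration.integral_cong refl) (simp add: algebra_simps cis_mult)
    also have "\<dots> = (complex_of_real (std_normal_density (\<sigma> * v)) * cis (- (x * v))) * Phi f v"
      unfolding Phi_def by (rule integral_mult_right_zero)
    finally show "(LINT y|lborel. ?h y v) = complex_of_real (std_normal_density (\<sigma> * v)) * (Phi f v * cis (- (x * v)))"
      by simp
  qed
  finally show ?thesis .
qed

text \<open>Gaussian smoothing of \<open>f\<close> converges to the inversion integral. Fatou's lemma then
  bounds \<open>f\<close>, which is what dominated convergence needs to identify the same limit as \<open>f\<close>.\<close>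
theorem fourier_inversion:
  assumes f: "is_density f" and cont: "continuous_on UNIV f" and int: "integrable lborel (Phi f)"
  shows "complex_of_real (f x) = complex_of_real (1 / (2 * pi)) * (LINT v|lborel. Phi f v * cis (- (x * v)))"
proof -
  note [measurable] = is_densityD(1)[OF f] borel_measurable_Phi[OF f]
  have fn: "\<And>x. 0 \<le> f x" using is_densityD[OF f] by auto
  define g where "g x = complex_of_real (1 / (2 * pi)) * (LINT v|lborel. Phi f v * cis (- (x * v)))" for x
  define \<sigma> where "\<sigma> k = inverse (real (Suc k))" for k
  have \<sigma>: "\<sigma> k > 0" for k by (simp add: \<sigma>_def)
  have \<sigma>0: "\<sigma> \<longlonglongrightarrow> 0" unfolding \<sigma>_def by (rule LIMSEQ_inverse_real_of_nat)
  define S where "S x k = (LINT z|lborel. f (x - \<sigma> k * z) * std_normal_density z)" for x k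
  have lim_g: "(\<lambda>k. complex_of_real (S x k)) \<longlonglongrightarrow> g x" for x
  proof -
    have "(\<lambda>k. LINT v|lborel. complex_of_real (std_normal_density (\<sigma> k * v)) * (Phi f v * cis (- (x * v))))
      \<longlonglongrightarrow> (LINT v|lborel. complex_of_real (1 / sqrt (2 * pi)) * (Phi f v * cis (- (x * v))))"
    proof (rule integral_dominated_convergence)
      show "integrable lborel (\<lambda>v. cmod (complex_of_real (1 / sqrt (2 * pi)) * Phi f v))"
        using int by (intro integrable_norm integrable_mult_right) auto
      show "AE v in lborel. (\<lambda>k. complex_of_real (std_normal_density (\<sigma> k * v)) * (Phi f v * cis (- (x * v))))
          \<longlonglongrightarrow> complex_of_real (1 / sqrt (2 * pi)) * (Phi f v * cis (- (x * v)))"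
        unfolding \<sigma>_def
        by (intro AE_I2 tendsto_mult tendsto_of_real tendsto_std_normal_density_scaled tendsto_const)
      show "AE v in lborel. cmod (complex_of_real (std_normal_density (\<sigma> k * v)) * (Phi f v * cis (- (x * v))))
          \<le> cmod (complex_of_real (1 / sqrt (2 * pi)) * Phi f v)" for k
        using mult_right_mono[OF std_normal_density_le norm_ge_zero, of "\<sigma> k * _" "Phi f _"]
        by (intro AE_I2) (simp add: norm_mult norm_divide)
    qed measurable
    then have "(\<lambda>k. complex_of_real (1 / sqrt (2 * pi)) * (LINT v|lborel. complex_of_real (std_normal_density (\<sigma> k * v)) * (Phi f v * cis (- (x * v)))))
      \<longlonglongrightarrow> complex_of_real (1 / sqrt (2 * pi)) * (LINT v|lborel. complex_of_real (1 / sqrt (2 * pi)) * (Phi f v * cis (- (x * v))))"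
      by (intro tendsto_mult tendsto_const)
    \<comment> \<open>One factor \<open>1 / sqrt (2 * pi)\<close> comes from the smoothing identity,
      the other from the limit of the Gaussian weight; together they give the
      \<open>1 / (2 * pi)\<close> of Fourier inversion.\<close>
    also have "complex_of_real (1 / sqrt (2 * pi)) * (LINT v|lborel. complex_of_real (1 / sqrt (2 * pi)) * (Phi f v * cis (- (x * v))))
       = complex_of_real (1 / sqrt (2 * pi) * (1 / sqrt (2 * pi))) * (LINT v|lborel. Phi f v * cis (- (x * v)))"
      by (subst integral_mult_right_zero) (simp only: of_real_mult mult.assoc)
    also have "1 / sqrt (2 * pi) * (1 / sqrt (2 * pi)) = 1 / (2 * pi)"
      by simp
    finally show ?thesis
      unfolding S_def convolution_gaussian_eq[OF f \<sigma>] g_def .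
  qed
  then have lim_Re: "(\<lambda>k. S x k) \<longlonglongrightarrow> Re (g x)" for x
    using tendsto_Re[OF lim_g] by simp
  have lim_f: "(\<lambda>k. f (x - \<sigma> k * z)) \<longlonglongrightarrow> f x" for x z
  proof -
    have "(\<lambda>k. x - \<sigma> k * z) \<longlonglongrightarrow> x - 0 * z"
      by (intro tendsto_intros \<sigma>0)
    then show ?thesis
      using cont by (auto simp: continuous_on_eq_continuous_at intro: isCont_tendsto_compose)
  qed
  have Sint: "integrable lborel (\<lambda>z. f (x - \<sigma> k * z) * std_normal_density z)" for x k
  proof (rule Bochner_Integration.integrable_bound)
    show "integrable lborel (\<lambda>z. f (x + (- \<sigma> k) * z) * (1 / sqrt (2 * pi)))"
      using is_densityD(3)[OF f] \<sigma>[of k] lborel_integrable_real_affine[of f "- \<sigma> k" x] by auto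
    show "AE z in lborel. norm (f (x - \<sigma> k * z) * std_normal_density z) \<le> norm (f (x + (- \<sigma> k) * z) * (1 / sqrt (2 * pi)))"
      using fn mult_left_mono[OF std_normal_density_le fn]
      by (intro AE_I2) (simp add: abs_mult)
  qed measurable
  \<comment> \<open>A bound on the inversion integral that is uniform in \<open>x\<close>. Once it
    is known to bound \<open>f\<close> as well, \<open>B * std_normal_density\<close> dominates the
    smoothing integrands.\<close>
  define B where "B = (1 / (2 * pi)) * (LINT v|lborel. cmod (Phi f v))"
  have B: "cmod (g x) \<le> B" for x
  proof -
    have "cmod (LINT v|lborel. Phi f v * cis (- (x * v))) \<le> (LINT v|lborel. cmod (Phi f v * cis (- (x * v))))"
      by (rule integral_norm_bound)
    then show ?thesis
      by (simp add: g_def B_def norm_mult norm_divide divide_right_mono)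
  qed
  have bounded: "f x \<le> B" for x
  proof -
    have "(\<integral>\<^sup>+ z. ennreal (f x * std_normal_density z) \<partial>lborel)
        = (\<integral>\<^sup>+ z. liminf (\<lambda>k. ennreal (f (x - \<sigma> k * z) * std_normal_density z)) \<partial>lborel)"
      by (intro nn_integral_cong lim_imp_Liminf[symmetric] tendsto_ennrealI tendsto_mult lim_f tendsto_const) auto
    also have "\<dots> \<le> liminf (\<lambda>k. \<integral>\<^sup>+ z. ennreal (f (x - \<sigma> k * z) * std_normal_density z) \<partial>lborel)"
      by (rule nn_integral_liminf) measurable
    also have "\<dots> = liminf (\<lambda>k. ennreal (S x k))"
      using Sint fn by (simp add: S_def nn_integral_eq_integral)
    also have "\<dots> = ennreal (Re (g x))"
      by (intro lim_imp_Liminf tendsto_ennrealI lim_Re) auto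
    also have "(\<integral>\<^sup>+ z. ennreal (f x * std_normal_density z) \<partial>lborel) = ennreal (f x)"
      using fn by (subst nn_integral_eq_integral) auto
    also have "ennreal (Re (g x)) \<le> ennreal B"
      using B[of x] complex_Re_le_cmod[of "g x"] by (intro ennreal_leI) linarith
    finally show "f x \<le> B"
      by (subst (asm) ennreal_le_iff) (auto simp: B_def)
  qed
  have "S x \<longlonglongrightarrow> (LINT z|lborel. f x * std_normal_density z)"
    unfolding S_def
  proof (rule integral_dominated_convergence)
    show "integrable lborel (\<lambda>z. B * std_normal_density z)" by auto
    show "AE z in lborel. (\<lambda>k. f (x - \<sigma> k * z) * std_normal_density z) \<longlonglongrightarrow> f x * std_normal_density z"
      by (intro AE_I2 tendsto_mult lim_f tendsto_const)
    show "AE z in lborel. norm (f (x - \<sigma> k * z) * std_normal_density z) \<le> B * std_normal_density z" for k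
      using fn bounded by (auto simp: abs_mult intro!: mult_right_mono)
  qed measurable
  then have "S x \<longlonglongrightarrow> f x"
    by simp
  then have "(\<lambda>k. complex_of_real (S x k)) \<longlonglongrightarrow> complex_of_real (f x)"
    by (rule tendsto_of_real)
  with lim_g show ?thesis
    unfolding g_def[symmetric] by (rule LIMSEQ_unique[rotated])
qed

section \<open>Moments of empirical means\<close>

text \<open>The decomposition into squared bias and variance: expanding around the mean, the cross
  term is linear in \<open>W y\<close> minus its mean and so integrates to zero.\<close>

lemma (in prob_space) second_moment_shift:
  fixes W :: "'a \<Rightarrow> complex"
  assumes [measurable]: "W \<in> borel_measurable M" and B: "\<And>y. cmod (W y) \<le> B"
  shows "(\<integral>\<^sup>+ y. ennreal ((cmod (W y - d))\<^sup>2) \<partial>M)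
    = ennreal ((cmod (integral\<^sup>L M W - d))\<^sup>2 + (LINT y|M. (cmod (W y - integral\<^sup>L M W))\<^sup>2))"
proof -
  have iW: "integrable M W"
    by (rule integrable_const_bound[of _ B]) (use B in auto)
  have isq: "integrable M (\<lambda>y. (cmod (W y - d))\<^sup>2)" for d
  proof (rule integrable_const_bound[of _ "(B + cmod d)\<^sup>2"])
    have "cmod (W y - d) \<le> B + cmod d" for y
      using norm_triangle_ineq4[of "W y" d] B[of y] by linarith
    then show "AE y in M. norm ((cmod (W y - d))\<^sup>2) \<le> (B + cmod d)\<^sup>2"
      by (auto intro!: power_mono)
  qed measurable
  let ?m = "integral\<^sup>L M W"
  \<comment> \<open>The complex plane is treated as a real inner product space, so the cross term is
    twice a real inner product.\<close>
  have split: "(cmod (W y - d))\<^sup>2 = (cmod (W y - ?m))\<^sup>2 + ((cmod (?m - d))\<^sup>2 + 2 * ((W y - ?m) \<bullet> (?m - d)))" for y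
    using dot_norm[of "W y - ?m" "?m - d"] by (simp add: field_simps)
  have "(LINT y|M. (cmod (W y - d))\<^sup>2)
     = (LINT y|M. (cmod (W y - ?m))\<^sup>2) + (LINT y|M. (cmod (?m - d))\<^sup>2 + 2 * ((W y - ?m) \<bullet> (?m - d)))"
    unfolding split[of _] using isq iW by (intro Bochner_Integration.integral_add) auto
  also have "(LINT y|M. (cmod (?m - d))\<^sup>2 + 2 * ((W y - ?m) \<bullet> (?m - d)))
      = (cmod (?m - d))\<^sup>2 + 2 * ((LINT y|M. W y - ?m) \<bullet> (?m - d))"
    using iW by (subst Bochner_Integration.integral_add) (auto simp: prob_space)
  also have "(LINT y|M. W y - ?m) = 0"
    using iW by (subst Bochner_Integration.integral_diff) (auto simp: prob_space)
  finally show ?thesis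
    by (subst nn_integral_eq_integral[OF isq]) (auto simp: add.commute)
qed

text \<open>Induction on \<open>n\<close> integrates out one coordinate at a time. With the last
  observation \<open>y\<close> fixed, the first \<open>n\<close> terms are compared with
  \<open>c - W y\<close>, which is why \<open>c\<close> is generalized; integrating over
  \<open>y\<close> is then \<open>second_moment_shift\<close>. Independence enters only through the
  product measure.\<close>

lemma (in prob_space) iid_sum_second_moment:
  fixes W :: "'a \<Rightarrow> complex"
  assumes W[measurable]: "W \<in> borel_measurable M" and B: "\<And>y. cmod (W y) \<le> B"
  shows "(\<integral>\<^sup>+ Y. ennreal ((cmod ((\<Sum>i<n. W (Y i)) - c))\<^sup>2) \<partial>PiM {..<n} (\<lambda>_. M))
    = ennreal ((cmod (of_nat n * integral\<^sup>L M W - c))\<^sup>2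
        + real n * (LINT y|M. (cmod (W y - integral\<^sup>L M W))\<^sup>2))"
proof (induction n arbitrary: c)
  case 0
  show ?case
    by (simp add: PiM_empty nn_integral_count_space_finite)
next
  case (Suc n)
  interpret product_sigma_finite "\<lambda>_::nat. M" ..
  let ?m = "integral\<^sup>L M W" and ?V = "LINT y|M. (cmod (W y - integral\<^sup>L M W))\<^sup>2"
  have "(\<integral>\<^sup>+ Y. ennreal ((cmod ((\<Sum>i<Suc n. W (Y i)) - c))\<^sup>2) \<partial>PiM {..<Suc n} (\<lambda>_. M))
     = (\<integral>\<^sup>+ y. \<integral>\<^sup>+ x. ennreal ((cmod ((\<Sum>i<n. W (x i)) - (c - W y)))\<^sup>2) \<partial>PiM {..<n} (\<lambda>_. M) \<partial>M)"
    unfolding lessThan_Suc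
    by (subst product_nn_integral_insert_rev) (auto simp: algebra_simps intro!: nn_integral_cong)
  also have "\<dots> = (\<integral>\<^sup>+ y. ennreal ((cmod (W y - (c - of_nat n * ?m)))\<^sup>2) + ennreal (real n * ?V) \<partial>M)"
    by (subst Suc.IH) (auto simp: algebra_simps intro!: nn_integral_cong)
  also have "\<dots> = (\<integral>\<^sup>+ y. ennreal ((cmod (W y - (c - of_nat n * ?m)))\<^sup>2) \<partial>M) + ennreal (real n * ?V)"
    by (subst nn_integral_add) (auto simp: emeasure_space_1)
  also have "\<dots> = ennreal ((cmod (?m - (c - of_nat n * ?m)))\<^sup>2 + ?V) + ennreal (real n * ?V)"
    by (subst second_moment_shift[OF W B]) simp
  also have "\<dots> = ennreal ((cmod (of_nat (Suc n) * ?m - c))\<^sup>2 + real (Suc n) * ?V)"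
    by (subst ennreal_plus[symmetric]) (auto simp: algebra_simps)
  finally show ?case .
qed

text \<open>Scaling the sum by 1 / n divides its variance term by n. The variance is then enlarged
  to the raw second moment, a quantity that both a sup bound and Plancherel control
  directly.\<close>

lemma (in prob_space) iid_mean_mse_le:
  fixes W :: "'a \<Rightarrow> complex"
  assumes W[measurable]: "W \<in> borel_measurable M" and B: "\<And>y. cmod (W y) \<le> B" and n: "n > 0"
  shows "(\<integral>\<^sup>+ Y. ennreal ((cmod ((1 / of_nat n) * (\<Sum>i<n. W (Y i)) - c))\<^sup>2) \<partial>PiM {..<n} (\<lambda>_. M))
    \<le> ennreal ((cmod (integral\<^sup>L M W - c))\<^sup>2) + ennreal (1 / real n) * (\<integral>\<^sup>+ y. ennreal ((cmod (W y))\<^sup>2) \<partial>M)"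
proof -
  let ?m = "integral\<^sup>L M W" and ?V = "LINT y|M. (cmod (W y - integral\<^sup>L M W))\<^sup>2"
  have V: "?V \<ge> 0" by simp
  have "(1 / of_nat n) * S - c = (1 / of_nat n) * (S - of_nat n * c)" for S
    using n by (simp add: field_simps)
  then have e: "ennreal ((cmod ((1 / of_nat n) * S - c))\<^sup>2)
      = ennreal ((1 / real n)\<^sup>2) * ennreal ((cmod (S - of_nat n * c))\<^sup>2)" for S
    by (simp only: norm_mult power_mult_distrib norm_divide norm_one norm_of_nat) (simp add: ennreal_mult)
  have "(\<integral>\<^sup>+ Y. ennreal ((cmod ((1 / of_nat n) * (\<Sum>i<n. W (Y i)) - c))\<^sup>2) \<partial>PiM {..<n} (\<lambda>_. M))
      = ennreal ((1 / real n)\<^sup>2) * ennreal ((cmod (of_nat n * ?m - of_nat n * c))\<^sup>2 + real n * ?V)"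
    unfolding e by (subst nn_integral_cmult) (auto simp: iid_sum_second_moment[OF W B])
  also have "cmod (of_nat n * ?m - of_nat n * c) = real n * cmod (?m - c)"
    by (simp add: right_diff_distrib[symmetric] norm_mult)
  also have "ennreal ((1 / real n)\<^sup>2) * ennreal ((real n * cmod (?m - c))\<^sup>2 + real n * ?V)
      = ennreal ((cmod (?m - c))\<^sup>2 + 1 / real n * ?V)"
    using n by (subst ennreal_mult[symmetric]) (auto simp: field_simps power2_eq_square)
  also have "\<dots> = ennreal ((cmod (?m - c))\<^sup>2) + ennreal (1 / real n) * ennreal ?V"
    using V by (simp add: ennreal_mult[symmetric])
  also have "ennreal ?V \<le> (\<integral>\<^sup>+ y. ennreal ((cmod (W y))\<^sup>2) \<partial>M)"
    using second_moment_shift[OF W B, of 0] by (simp add: ennreal_leI)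
  finally show ?thesis
    by (simp add: add_left_mono mult_left_mono)
qed

text \<open>An observation is a sum of two independent variables, so its exponential factorizes.
  This product form is what division by \<open>Phi feps\<close> undoes.\<close>

lemma char_convolution:
  assumes "real_distribution M" "real_distribution N"
  shows "char (M \<star> N) t = char M t * char N t"
proof -
  interpret M: real_distribution M by fact
  interpret N: real_distribution N by fact
  interpret MN: pair_prob_space M N ..
  have int: "integrable (M \<Otimes>\<^sub>M N) (\<lambda>p. iexp (t * (fst p + snd p)))"
    by (rule MN.integrable_const_bound[of _ 1]) auto
  have "char (M \<star> N) t = (LINT p|(M \<Otimes>\<^sub>M N). iexp (t * (fst p + snd p)))"
    unfolding char_def convolution_def by (subst integral_distr) (auto simp: case_prod_beta)
  also have "\<dots> = (LINT x|M. LINT y|N. iexp (t * x) * iexp (t * y))"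
    by (subst MN.integral_fst'[OF int, symmetric]) (simp add: algebra_simps exp_add)
  also have "\<dots> = char M t * char N t"
    unfolding char_def by simp
  finally show ?thesis .
qed

text \<open>Integrate the pointwise inequality p q \<le> (t / 2) p^2 + q^2 / (2 t) for a single
  well-chosen \<open>t\<close>.\<close>

lemma cauchy_schwarz_nn_integral:
  fixes p q :: "'a \<Rightarrow> real"
  assumes [measurable]: "p \<in> borel_measurable M" "q \<in> borel_measurable M"
    and P: "(\<integral>\<^sup>+ x. ennreal ((p x)\<^sup>2) \<partial>M) \<le> ennreal P" "P > 0"
    and Q: "(\<integral>\<^sup>+ x. ennreal ((q x)\<^sup>2) \<partial>M) \<le> ennreal Q" "Q > 0"
  shows "(\<integral>\<^sup>+ x. ennreal (p x * q x) \<partial>M) \<le> ennreal (sqrt (P * Q))"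
proof -
  \<comment> \<open>This value balances the two terms: each becomes half of
    \<open>sqrt (P * Q)\<close>.\<close>
  define t where "t = sqrt (Q / P)"
  have t: "t > 0" using P(2) Q(2) by (simp add: t_def)
  have am: "p x * q x \<le> t / 2 * (p x)\<^sup>2 + 1 / (2 * t) * (q x)\<^sup>2" for x
  proof -
    have "0 \<le> (t * p x - q x)\<^sup>2" by simp
    then have "2 * t * (p x * q x) \<le> t * t * (p x)\<^sup>2 + (q x)\<^sup>2"
      by (simp add: power2_eq_square algebra_simps)
    then have "p x * q x \<le> (t * t * (p x)\<^sup>2 + (q x)\<^sup>2) / (2 * t)"
      using t by (simp add: pos_le_divide_eq mult.commute mult.left_commute)
    also have "\<dots> = t / 2 * (p x)\<^sup>2 + 1 / (2 * t) * (q x)\<^sup>2"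
      using t by (simp add: field_simps)
    finally show ?thesis .
  qed
  have "(\<integral>\<^sup>+ x. ennreal (p x * q x) \<partial>M) \<le> (\<integral>\<^sup>+ x. ennreal (t / 2) * ennreal ((p x)\<^sup>2) + ennreal (1 / (2 * t)) * ennreal ((q x)\<^sup>2) \<partial>M)"
    using t am by (intro nn_integral_mono) (simp add: ennreal_mult[symmetric] ennreal_plus[symmetric] ennreal_leI del: ennreal_plus)
  also have "\<dots> = ennreal (t / 2) * (\<integral>\<^sup>+ x. ennreal ((p x)\<^sup>2) \<partial>M) + ennreal (1 / (2 * t)) * (\<integral>\<^sup>+ x. ennreal ((q x)\<^sup>2) \<partial>M)"
    by (simp add: nn_integral_add nn_integral_cmult)
  also have "\<dots> \<le> ennreal (t / 2) * ennreal P + ennreal (1 / (2 * t)) * ennreal Q"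
    using P Q by (intro add_mono mult_left_mono) auto
  also have "\<dots> = ennreal (t / 2 * P + 1 / (2 * t) * Q)"
    using P Q t by (simp add: ennreal_mult[symmetric] ennreal_plus[symmetric] del: ennreal_plus)
  also have "t / 2 * P + 1 / (2 * t) * Q = sqrt (P * Q)"
  proof -
    have "t * P = sqrt (P * Q)"
      using P(2) Q(2) by (simp add: t_def real_sqrt_divide real_sqrt_mult) (metis real_div_sqrt less_imp_le mult.commute times_divide_eq_right)
    moreover have "Q / t = sqrt (P * Q)"
      using P(2) Q(2) by (simp add: t_def real_sqrt_divide real_sqrt_mult) (metis real_div_sqrt less_imp_le mult.commute times_divide_eq_right)
    ultimately show ?thesis by (simp add: field_simps)
  qed
  finally show ?thesis .
qed

section \<open>Risk bounds at a fixed sample size\<close>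

text \<open>\<open>decon P a x y\<close> is the paper's \<open>K\<^sub>n((x - y) / h) / h\<close> with \<open>a = 1 / h\<close>, after the
  substitution \<open>v = u / h\<close> in the integral defining \<open>K\<^sub>n\<close>.\<close>
definition decon :: "(real \<Rightarrow> complex) \<Rightarrow> real \<Rightarrow> real \<Rightarrow> real \<Rightarrow> complex" where
  "decon P a x y = complex_of_real (1 / (2 * pi)) *
     (LINT v|lborel. (indicator {-a..a} v * (cis (y * v) / P v)) * cis (- (x * v)))"

lemma kernel_est_eq_decon:
  assumes a: "a > 0"
  shows "kernel_est P n (1 / a) Y x = (1 / of_nat n) * (\<Sum>i<n. decon P a x (Y i))"
proof -
  \<comment> \<open>The substitution v = a u has Jacobian \<open>a\<close>. The resulting division
    by \<open>a\<close> is undone by the prefactor 1 / h = a of the estimator.\<close>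
  have dk: "decon_kernel P (1 / a) ((x - y) / (1 / a)) = decon P a x y / of_real a" for y
  proof -
    let ?F = "\<lambda>v. (indicator {-a..a} v * (cis (y * v) / P v)) * cis (- (x * v))"
    have "(LINT v|lborel. ?F v) = a *\<^sub>R (LINT u|lborel. ?F (a * u))"
      using lborel_integral_real_affine[of a ?F 0] a by simp
    also have "(LINT u|lborel. ?F (a * u)) = (LINT u:{-1..1}|lborel. cis (- ((x - y) / (1 / a) * u)) / P (u / (1 / a)))"
      unfolding set_lebesgue_integral_def
    proof (rule Bochner_Integration.integral_cong[OF refl])
      fix u
      have "(indicator {-a..a} (a * u) :: complex) = indicator {-1..1} u"
        using a mult_le_cancel_left_pos[of a "-1" u] mult_le_cancel_left_pos[of a u 1]
        by (auto simp: indicator_def)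
      moreover have "cis (y * (a * u)) * cis (- (x * (a * u))) = cis (- ((x - y) / (1 / a) * u))"
        by (simp add: cis_mult algebra_simps)
      ultimately show "?F (a * u) = indicator {-1..1} u *\<^sub>R (cis (- ((x - y) / (1 / a) * u)) / P (u / (1 / a)))"
        by (simp add: scaleR_conv_of_real of_real_indicator mult.commute)
    qed
    finally show ?thesis
      using a by (simp add: decon_def decon_kernel_def scaleR_conv_of_real)
  qed
  show ?thesis
    unfolding kernel_est_def dk using a by (simp add: sum_divide_distrib[symmetric])
qed

text \<open>The growth of the inverse noise characteristic function is condensed into one number
  \<open>K\<close> on the window [-a, a], so the bounds at fixed sample size stay free of
  asymptotics.\<close>

locale deconvolution =
  fixes feps :: "real \<Rightarrow> real" and a K :: real
  assumes feps: "is_density feps"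
    and nonzero: "\<And>u. Phi feps u \<noteq> 0"
    and a: "a > 0"
    and K: "\<And>v. \<bar>v\<bar> \<le> a \<Longrightarrow> 1 / cmod (Phi feps v) \<le> K"
begin

section \<open>Size of the deconvolution kernel\<close>

lemma Phi_feps_measurable [measurable]: "Phi feps \<in> borel_measurable borel"
  by (rule borel_measurable_Phi[OF feps])

abbreviation W :: "real \<Rightarrow> real \<Rightarrow> complex" where
  "W \<equiv> decon (Phi feps) a"

lemma W_measurable: "(\<lambda>p. W (fst p) (snd p)) \<in> borel_measurable (borel \<Otimes>\<^sub>M borel)"
  unfolding decon_def by measurable

lemma W_measurable' [measurable (raw)]:
  assumes [measurable]: "g \<in> borel_measurable N" "h \<in> borel_measurable N"
  shows "(\<lambda>z. W (g z) (h z)) \<in> borel_measurable N"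
proof -
  have "(\<lambda>z. (g z, h z)) \<in> measurable N (borel \<Otimes>\<^sub>M borel)" by measurable
  from measurable_comp[OF this W_measurable] show ?thesis by (simp add: comp_def)
qed

lemma K_nonneg: "0 \<le> K"
  using K[of 0] a order_trans[OF _ K[of 0]] by auto

lemma integrand_norm_le: "cmod (indicator {-a..a} v * (cis (y * v) / Phi feps v)) \<le> K * indicator {-a..a} v"
  using K[of v] by (auto simp: indicator_def norm_divide abs_le_iff)

lemma integrable_window: "integrable lborel (\<lambda>v. K * indicator {-a..a} v)"
  using a by (intro integrable_mult_right integrable_real_indicator) auto

lemma integrable_integrand: "integrable lborel (\<lambda>v. indicator {-a..a} v * (cis (y * v) / Phi feps v))"
  by (rule Bochner_Integration.integrable_bound[OF integrable_window])
     (use integrand_norm_le K_nonneg in \<open>auto simp del: times_divide_eq_right\<close>)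

text \<open>The integrand is at most \<open>K\<close> on a window of length 2 a. The bound is
  uniform in both arguments, so it supplies the boundedness asked for by the moment lemmas and also
  the pointwise variance.\<close>

lemma norm_W_le: "cmod (W x y) \<le> a * K / pi"
proof -
  have "cmod (LINT v|lborel. (indicator {-a..a} v * (cis (y * v) / Phi feps v)) * cis (- (x * v)))
      \<le> (LINT v|lborel. K * indicator {-a..a} v)"
  proof (rule Bochner_Integration.integral_norm_bound_integral)
    show "integrable lborel (\<lambda>v. (indicator {-a..a} v * (cis (y * v) / Phi feps v)) * cis (- (x * v)))"
      by (rule Bochner_Integration.integrable_bound[OF integrable_integrand[of y]])
         (auto simp: norm_mult norm_divide)
    show "cmod ((indicator {-a..a} v * (cis (y * v) / Phi feps v)) * cis (- (x * v))) \<le> K * indicator {-a..a} v" for v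
      using integrand_norm_le[of v y] by (simp add: norm_mult norm_divide)
  qed (rule integrable_window)
  also have "\<dots> = 2 * a * K"
    using a by simp
  finally show ?thesis
    by (simp add: decon_def norm_mult norm_divide field_simps)
qed

text \<open>For fixed \<open>y\<close>, the kernel is a Fourier transform in \<open>x\<close> of a
  function bounded by \<open>K\<close> on the window; Plancherel gives (1 / (2 pi))^2 * 2 pi * 2 a
  K^2.\<close>

lemma nn_integral_norm_W_sq_le:
  "(\<integral>\<^sup>+ x. ennreal ((cmod (W x y))\<^sup>2) \<partial>lborel) \<le> ennreal (a * K\<^sup>2 / pi)"
proof -
  let ?g = "\<lambda>v. indicator {-a..a} v * (cis (y * v) / Phi feps v)"
  have "(\<integral>\<^sup>+ x. ennreal ((cmod (W x y))\<^sup>2) \<partial>lborel)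
      = (\<integral>\<^sup>+ x. ennreal ((1 / (2 * pi))\<^sup>2) * ennreal ((cmod (LINT v|lborel. ?g v * cis (- (x * v))))\<^sup>2) \<partial>lborel)"
    unfolding decon_def
    by (intro nn_integral_cong) (simp add: norm_mult norm_divide power_divide ennreal_mult[symmetric])
  also have "\<dots> = ennreal ((1 / (2 * pi))\<^sup>2) * (\<integral>\<^sup>+ x. ennreal ((cmod (LINT v|lborel. ?g v * cis (- (x * v))))\<^sup>2) \<partial>lborel)"
    by (rule nn_integral_cmult) measurable
  also have "\<dots> \<le> ennreal ((1 / (2 * pi))\<^sup>2) * (ennreal (2 * pi) * (\<integral>\<^sup>+ v. ennreal ((cmod (?g v))\<^sup>2) \<partial>lborel))"
    by (intro mult_left_mono plancherel_le integrable_integrand) auto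
  also have "(\<integral>\<^sup>+ v. ennreal ((cmod (?g v))\<^sup>2) \<partial>lborel) \<le> (\<integral>\<^sup>+ v. ennreal (K\<^sup>2) * indicator {-a..a} v \<partial>lborel)"
  proof (rule nn_integral_mono)
    fix v
    show "ennreal ((cmod (?g v))\<^sup>2) \<le> ennreal (K\<^sup>2) * indicator {-a..a} v"
      using power_mono[OF integrand_norm_le[of v y], of 2] by (auto simp: indicator_def ennreal_leI)
  qed
  also have "\<dots> = ennreal (2 * a * K\<^sup>2)"
    using a by (subst nn_integral_cmult_indicator) (auto simp: ennreal_mult[symmetric] mult.commute)
  also have "ennreal ((1 / (2 * pi))\<^sup>2) * (ennreal (2 * pi) * ennreal (2 * a * K\<^sup>2)) = ennreal (a * K\<^sup>2 / pi)"
    using a by (simp add: ennreal_mult[symmetric]) (simp add: power2_eq_square field_simps)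
  finally show ?thesis
    by (simp add: mult_left_mono)
qed

end

text \<open>\<open>J\<close> stands for any bound on the mass of the inverse smoothness weight
  outside the window; an explicit value is inserted only in the asymptotic part.\<close>

locale deconvolution_target = deconvolution +
  fixes f :: "real \<Rightarrow> real" and \<alpha> r L J :: real
  assumes f_class: "f \<in> A_class \<alpha> r L"
    and pos: "\<alpha> > 0" "r > 0" "L > 0" "J > 0"
    and J: "(\<integral>\<^sup>+ v. ennreal (exp (- 2 * \<alpha> * \<bar>v\<bar> powr r)) * indicator (- {-a..a}) v \<partial>lborel) \<le> ennreal J"
begin

section \<open>Bias and risk for one density of the class\<close>

lemma f: "is_density f" and f_cont: "continuous_on UNIV f"
  and f_smooth: "(\<integral>\<^sup>+ u. ennreal ((cmod (Phi f u))\<^sup>2 * exp (2 * \<alpha> * \<bar>u\<bar> powr r)) \<partial>lborel) \<le> ennreal (2 * pi * L)"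
  using f_class by (auto simp: A_class_def)

lemma f_measurable [measurable]: "f \<in> borel_measurable borel"
  using is_densityD[OF f] by simp

lemma Phi_f_measurable [measurable]: "Phi f \<in> borel_measurable borel"
  by (rule borel_measurable_Phi[OF f])

text \<open>The law of a single observation; \<open>sample_law\<close> is its n-fold
  product.\<close>

definition \<mu> :: "real measure" where
  "\<mu> = (density lborel (\<lambda>x. ennreal (f x)) \<star> density lborel (\<lambda>x. ennreal (feps x)))"

lemma sets_\<mu> [measurable_cong]: "sets \<mu> = sets borel"
  by (simp add: \<mu>_def)

lemma prob_space_\<mu>: "prob_space \<mu>"
proof -
  interpret M: real_distribution "density lborel (\<lambda>x. ennreal (f x))" using is_densityD[OF f] by simp
  interpret N: real_distribution "density lborel (\<lambda>x. ennreal (feps x))" using is_densityD[OF feps] by simp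
  interpret MN: pair_prob_space "density lborel (\<lambda>x. ennreal (f x))" "density lborel (\<lambda>x. ennreal (feps x))" ..
  show ?thesis
    unfolding \<mu>_def convolution_def by (rule MN.prob_space_distr) simp
qed

sublocale \<mu>: prob_space \<mu>
  by (rule prob_space_\<mu>)

lemma integral_cis_\<mu>: "(LINT y|\<mu>. cis (y * v)) = Phi f v * Phi feps v"
proof -
  have "(LINT y|\<mu>. cis (y * v)) = char \<mu> v"
    by (simp add: char_def cis_eq_iexp mult.commute)
  then show ?thesis
    using char_convolution[of "density lborel (\<lambda>x. ennreal (f x))" "density lborel (\<lambda>x. ennreal (feps x))" v]
      is_densityD(4)[OF f] is_densityD(4)[OF feps]
    by (simp add: \<mu>_def Phi_eq_char[OF f] Phi_eq_char[OF feps])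
qed

text \<open>After Fubini the expectation of \<open>cis (y * v)\<close> is
  \<open>Phi f v * Phi feps v\<close>, and the noise factor cancels against the denominator of the
  kernel. What remains is the inversion integral of \<open>f\<close> cut off to the window.\<close>

lemma expectation_W:
  "(LINT y|\<mu>. W x y) = complex_of_real (1 / (2 * pi)) * (LINT v|lborel. (indicator {-a..a} v * Phi f v) * cis (- (x * v)))"
proof -
  interpret yv: pair_sigma_finite \<mu> "lborel :: real measure" ..
  let ?h = "\<lambda>y v. (indicator {-a..a} v * (cis (y * v) / Phi feps v)) * cis (- (x * v))"
  have int: "integrable (\<mu> \<Otimes>\<^sub>M lborel) (\<lambda>(y, v). ?h y v)"
  proof (rule yv.Fubini_integrable)
    have "integrable lborel (\<lambda>v. ?h y v)" for y
      by (rule Bochner_Integration.integrable_bound[OF integrable_integrand[of y]]) (auto simp: norm_mult norm_divide)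
    then show "AE y in \<mu>. integrable lborel (\<lambda>v. case (y, v) of (y, v) \<Rightarrow> ?h y v)"
      by simp
    \<comment> \<open>Since \<open>cis\<close> has modulus 1, the inner integral is the same for
      every \<open>y\<close>, and constants are integrable under a probability measure.\<close>
    show "integrable \<mu> (\<lambda>y. LINT v|lborel. cmod (case (y, v) of (y, v) \<Rightarrow> ?h y v))"
      by (simp add: norm_mult norm_divide)
  qed measurable
  have "(LINT y|\<mu>. W x y) = complex_of_real (1 / (2 * pi)) * (LINT y|\<mu>. LINT v|lborel. ?h y v)"
    unfolding decon_def by (rule integral_mult_right_zero)
  also have "(LINT y|\<mu>. LINT v|lborel. ?h y v) = (LINT v|lborel. LINT y|\<mu>. ?h y v)"
    by (rule yv.Fubini_integral[OF int, symmetric])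
  also have "\<dots> = (LINT v|lborel. (indicator {-a..a} v * Phi f v) * cis (- (x * v)))"
  proof (rule Bochner_Integration.integral_cong[OF refl])
    fix v
    have "(LINT y|\<mu>. ?h y v) = (LINT y|\<mu>. (indicator {-a..a} v / Phi feps v * cis (- (x * v))) * cis (y * v))"
      by (intro Bochner_Integration.integral_cong refl) (simp add: mult_ac)
    also have "\<dots> = (indicator {-a..a} v / Phi feps v * cis (- (x * v))) * (Phi f v * Phi feps v)"
      by (subst integral_mult_right_zero) (simp add: integral_cis_\<mu>)
    also have "\<dots> = (indicator {-a..a} v * Phi f v) * cis (- (x * v))"
      using nonzero[of v] by simp
    finally show "(LINT y|\<mu>. ?h y v) = \<dots>" .
  qed
  finally show ?thesis .
qed

text \<open>Cauchy--Schwarz after multiplying and dividing by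
  \<open>exp (\<alpha> * \<bar>v\<bar> powr r)\<close>: one factor is controlled by the class, with
  2 pi L, the other by \<open>J\<close>.\<close>

lemma tail_Phi_le: "(\<integral>\<^sup>+ v. ennreal (cmod (indicator (- {-a..a}) v * Phi f v)) \<partial>lborel) \<le> ennreal (sqrt (2 * pi * L * J))"
proof -
  let ?e = "\<lambda>v. exp (\<alpha> * \<bar>v\<bar> powr r)"
  have "(\<integral>\<^sup>+ v. ennreal (cmod (indicator (- {-a..a}) v * Phi f v)) \<partial>lborel)
      = (\<integral>\<^sup>+ v. ennreal ((cmod (Phi f v) * ?e v) * (indicator (- {-a..a}) v / ?e v)) \<partial>lborel)"
    by (intro nn_integral_cong) (auto simp: indicator_def)
  also have "\<dots> \<le> ennreal (sqrt (2 * pi * L * J))"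
  proof (rule cauchy_schwarz_nn_integral)
    have "(\<integral>\<^sup>+ v. ennreal ((cmod (Phi f v) * ?e v)\<^sup>2) \<partial>lborel)
        = (\<integral>\<^sup>+ u. ennreal ((cmod (Phi f u))\<^sup>2 * exp (2 * \<alpha> * \<bar>u\<bar> powr r)) \<partial>lborel)"
      by (intro nn_integral_cong) (simp add: power_mult_distrib exp_double[symmetric] mult.assoc)
    then show "(\<integral>\<^sup>+ v. ennreal ((cmod (Phi f v) * ?e v)\<^sup>2) \<partial>lborel) \<le> ennreal (2 * pi * L)"
      using f_smooth by simp
    have "(\<integral>\<^sup>+ v. ennreal ((indicator (- {-a..a}) v / ?e v)\<^sup>2) \<partial>lborel)
       = (\<integral>\<^sup>+ v. ennreal (exp (- 2 * \<alpha> * \<bar>v\<bar> powr r)) * indicator (- {-a..a}) v \<partial>lborel)"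
      by (intro nn_integral_cong)
         (auto simp: indicator_def power_divide exp_double[symmetric] mult.assoc exp_minus inverse_eq_divide)
    then show "(\<integral>\<^sup>+ v. ennreal ((indicator (- {-a..a}) v / ?e v)\<^sup>2) \<partial>lborel) \<le> ennreal J"
      using J by simp
  qed (use pos in \<open>auto\<close>)
  finally show ?thesis .
qed

lemma integrable_Phi_tail: "integrable lborel (\<lambda>v. indicator (- {-a..a}) v * Phi f v)"
  by (rule integrableI_bounded) (use tail_Phi_le in \<open>auto intro: le_less_trans\<close>)

lemma integrable_Phi_window: "integrable lborel (\<lambda>v. indicator {-a..a} v * Phi f v)"
proof (rule Bochner_Integration.integrable_bound)
  show "integrable lborel (\<lambda>v. indicator {-a..a} v :: real)"
    using a by (intro integrable_real_indicator) auto
  interpret M: real_distribution "density lborel (\<lambda>x. ennreal (f x))" using is_densityD[OF f] by simp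
  show "AE v in lborel. cmod (indicator {-a..a} v * Phi f v) \<le> norm (indicator {-a..a} v :: real)"
    using M.cmod_char_le_1 by (intro AE_I2) (auto simp: indicator_def Phi_eq_char[OF f])
qed measurable

text \<open>On the bounded window \<open>Phi f\<close> has modulus at most 1, and the tail has just
  been bounded. This is the integrability that \<open>fourier_inversion\<close> asks for.\<close>

lemma integrable_Phi: "integrable lborel (Phi f)"
proof -
  have "integrable lborel (\<lambda>v. indicator {-a..a} v * Phi f v + indicator (- {-a..a}) v * Phi f v)"
    by (intro Bochner_Integration.integrable_add integrable_Phi_window integrable_Phi_tail)
  also have "(\<lambda>v. indicator {-a..a} v * Phi f v + indicator (- {-a..a}) v * Phi f v) = Phi f"
    by (auto simp: indicator_def fun_eq_iff)
  finally show ?thesis .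
qed

text \<open>The mean of the kernel is the truncated inversion integral and \<open>f x\<close> is the
  full one, so the bias is minus the discarded tail.\<close>

lemma bias_eq:
  "(LINT y|\<mu>. W x y) - complex_of_real (f x)
    = - complex_of_real (1 / (2 * pi)) * (LINT v|lborel. (indicator (- {-a..a}) v * Phi f v) * cis (- (x * v)))"
proof -
  have i: "integrable lborel (\<lambda>v. g v * cis (- (x * v)))" if "integrable lborel g" for g :: "real \<Rightarrow> complex"
  proof -
    have [measurable]: "g \<in> borel_measurable lborel" using that by auto
    show ?thesis
      by (rule Bochner_Integration.integrable_bound[OF that]) (auto simp: norm_mult)
  qed
  have "(LINT v|lborel. Phi f v * cis (- (x * v)))
      = (LINT v|lborel. (indicator {-a..a} v * Phi f v) * cis (- (x * v)) + (indicator (- {-a..a}) v * Phi f v) * cis (- (x * v)))"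
    by (intro Bochner_Integration.integral_cong) (auto simp: indicator_def)
  also have "\<dots> = (LINT v|lborel. (indicator {-a..a} v * Phi f v) * cis (- (x * v)))
      + (LINT v|lborel. (indicator (- {-a..a}) v * Phi f v) * cis (- (x * v)))"
    by (intro Bochner_Integration.integral_add i integrable_Phi_window integrable_Phi_tail)
  finally show ?thesis
    unfolding expectation_W fourier_inversion[OF f f_cont integrable_Phi, of x]
    by (simp only: distrib_left) simp
qed

lemma bias_pointwise: "(cmod ((LINT y|\<mu>. W x y) - complex_of_real (f x)))\<^sup>2 \<le> L * J / (2 * pi)"
proof -
  have "ennreal (cmod (LINT v|lborel. (indicator (- {-a..a}) v * Phi f v) * cis (- (x * v))))
      \<le> (\<integral>\<^sup>+ v. ennreal (cmod ((indicator (- {-a..a}) v * Phi f v) * cis (- (x * v)))) \<partial>lborel)"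
  proof (rule integral_norm_bound_ennreal)
    show "integrable lborel (\<lambda>v. indicator (- {-a..a}) v * Phi f v * cis (- (x * v)))"
      by (rule Bochner_Integration.integrable_bound[OF integrable_Phi_tail]) (auto simp: norm_mult)
  qed
  also have "\<dots> \<le> ennreal (sqrt (2 * pi * L * J))"
    using tail_Phi_le by (simp add: norm_mult)
  finally have le: "cmod (LINT v|lborel. (indicator (- {-a..a}) v * Phi f v) * cis (- (x * v))) \<le> sqrt (2 * pi * L * J)"
    using pos by (subst (asm) ennreal_le_iff) auto
  have "(cmod ((LINT y|\<mu>. W x y) - complex_of_real (f x)))\<^sup>2
      = (1 / (2 * pi))\<^sup>2 * (cmod (LINT v|lborel. (indicator (- {-a..a}) v * Phi f v) * cis (- (x * v))))\<^sup>2"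
    unfolding bias_eq by (simp add: norm_mult norm_divide power_divide)
  also have "\<dots> \<le> (1 / (2 * pi))\<^sup>2 * (sqrt (2 * pi * L * J))\<^sup>2"
    using le by (intro mult_left_mono power_mono) auto
  also have "\<dots> = L * J / (2 * pi)"
    using pos by (simp add: power2_eq_square field_simps)
  finally show ?thesis .
qed

text \<open>Plancherel moves the bias to the frequency side, where it lives outside the window.
  There \<open>exp (2 * \<alpha> * \<bar>v\<bar> powr r)\<close> is at least its value at
  \<open>a\<close>, so inserting the weight costs the factor
  \<open>exp (- 2 * \<alpha> * a powr r)\<close>.\<close>

lemma bias_L2:
  "(\<integral>\<^sup>+ x. ennreal ((cmod ((LINT y|\<mu>. W x y) - complex_of_real (f x)))\<^sup>2) \<partial>lborel) \<le> ennreal (L * exp (- 2 * \<alpha> * a powr r))"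
proof -
  let ?g = "\<lambda>v. indicator (- {-a..a}) v * Phi f v"
  have "(\<integral>\<^sup>+ x. ennreal ((cmod ((LINT y|\<mu>. W x y) - complex_of_real (f x)))\<^sup>2) \<partial>lborel)
      = (\<integral>\<^sup>+ x. ennreal ((1 / (2 * pi))\<^sup>2) * ennreal ((cmod (LINT v|lborel. ?g v * cis (- (x * v))))\<^sup>2) \<partial>lborel)"
    unfolding bias_eq
    by (intro nn_integral_cong) (simp add: norm_mult norm_divide power_divide ennreal_mult[symmetric])
  also have "\<dots> = ennreal ((1 / (2 * pi))\<^sup>2) * (\<integral>\<^sup>+ x. ennreal ((cmod (LINT v|lborel. ?g v * cis (- (x * v))))\<^sup>2) \<partial>lborel)"
    by (rule nn_integral_cmult) measurable
  also have "\<dots> \<le> ennreal ((1 / (2 * pi))\<^sup>2) * (ennreal (2 * pi) * (\<integral>\<^sup>+ v. ennreal ((cmod (?g v))\<^sup>2) \<partial>lborel))"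
    by (intro mult_left_mono plancherel_le integrable_Phi_tail) auto
  also have "(\<integral>\<^sup>+ v. ennreal ((cmod (?g v))\<^sup>2) \<partial>lborel)
      \<le> (\<integral>\<^sup>+ v. ennreal (exp (- 2 * \<alpha> * a powr r)) * ennreal ((cmod (Phi f v))\<^sup>2 * exp (2 * \<alpha> * \<bar>v\<bar> powr r)) \<partial>lborel)"
  proof (rule nn_integral_mono)
    fix v
    show "ennreal ((cmod (?g v))\<^sup>2) \<le> ennreal (exp (- 2 * \<alpha> * a powr r)) * ennreal ((cmod (Phi f v))\<^sup>2 * exp (2 * \<alpha> * \<bar>v\<bar> powr r))"
    proof (cases "v \<in> {-a..a}")
      case False
      then have "a powr r \<le> \<bar>v\<bar> powr r"
        using a pos by (intro powr_mono2) auto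
      then have "1 \<le> exp (- 2 * \<alpha> * a powr r) * exp (2 * \<alpha> * \<bar>v\<bar> powr r)"
        using pos by (simp add: exp_add[symmetric])
      then have "(cmod (Phi f v))\<^sup>2 * 1 \<le> (cmod (Phi f v))\<^sup>2 * (exp (- 2 * \<alpha> * a powr r) * exp (2 * \<alpha> * \<bar>v\<bar> powr r))"
        by (intro mult_left_mono) auto
      then show ?thesis
        using False by (simp add: ennreal_mult[symmetric] ennreal_leI mult_ac)
    qed simp
  qed
  also have "\<dots> = ennreal (exp (- 2 * \<alpha> * a powr r)) * (\<integral>\<^sup>+ v. ennreal ((cmod (Phi f v))\<^sup>2 * exp (2 * \<alpha> * \<bar>v\<bar> powr r)) \<partial>lborel)"
    by (rule nn_integral_cmult) measurable
  also have "\<dots> \<le> ennreal (exp (- 2 * \<alpha> * a powr r)) * ennreal (2 * pi * L)"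
    by (intro mult_left_mono f_smooth) auto
  also have "ennreal ((1 / (2 * pi))\<^sup>2) * (ennreal (2 * pi) * (ennreal (exp (- 2 * \<alpha> * a powr r)) * ennreal (2 * pi * L)))
      = ennreal (L * exp (- 2 * \<alpha> * a powr r))"
    using pos by (simp add: ennreal_mult[symmetric]) (simp add: power2_eq_square field_simps)
  finally show ?thesis
    by (simp add: mult_left_mono)
qed

text \<open>Bias and second moment are left unevaluated, so that the same inequality can be bounded
  at a point or integrated over \<open>x\<close>.\<close>

lemma mse_le:
  assumes "n > 0"
  shows "(\<integral>\<^sup>+ Y. ennreal ((cmod (kernel_est (Phi feps) n (1 / a) Y x - complex_of_real (f x)))\<^sup>2) \<partial>sample_law f feps n)
    \<le> ennreal ((cmod ((LINT y|\<mu>. W x y) - complex_of_real (f x)))\<^sup>2)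
      + ennreal (1 / real n) * (\<integral>\<^sup>+ y. ennreal ((cmod (W x y))\<^sup>2) \<partial>\<mu>)"
  unfolding kernel_est_eq_decon[OF a] sample_law_def \<mu>_def[symmetric]
  by (rule \<mu>.iid_mean_mse_le[OF _ norm_W_le assms]) measurable

lemma mse_pointwise_le:
  assumes n: "n > 0"
  shows "(\<integral>\<^sup>+ Y. ennreal ((cmod (kernel_est (Phi feps) n (1 / a) Y x - complex_of_real (f x)))\<^sup>2) \<partial>sample_law f feps n)
    \<le> ennreal (L * J / (2 * pi) + (a * K / pi)\<^sup>2 / real n)"
proof -
  have "(\<integral>\<^sup>+ y. ennreal ((cmod (W x y))\<^sup>2) \<partial>\<mu>) \<le> (\<integral>\<^sup>+ y. ennreal ((a * K / pi)\<^sup>2) \<partial>\<mu>)"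
    by (intro nn_integral_mono ennreal_leI power_mono norm_W_le) auto
  also have "\<dots> = ennreal ((a * K / pi)\<^sup>2)"
    by (simp add: \<mu>.emeasure_space_1)
  finally have "ennreal ((cmod ((LINT y|\<mu>. W x y) - complex_of_real (f x)))\<^sup>2)
      + ennreal (1 / real n) * (\<integral>\<^sup>+ y. ennreal ((cmod (W x y))\<^sup>2) \<partial>\<mu>)
      \<le> ennreal (L * J / (2 * pi)) + ennreal (1 / real n) * ennreal ((a * K / pi)\<^sup>2)"
    by (intro add_mono mult_left_mono ennreal_leI bias_pointwise) auto
  also have "\<dots> = ennreal (L * J / (2 * pi) + (a * K / pi)\<^sup>2 / real n)"
    using pos by (subst ennreal_mult[symmetric]) (auto simp: ennreal_plus[symmetric] simp del: ennreal_plus)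
  finally show ?thesis
    using mse_le[OF n] order_trans by blast
qed

text \<open>Tonelli is applied twice: first to put the sample integral inside, where
  \<open>mse_le\<close> applies at each \<open>x\<close>, then to put the \<open>x\<close> integral
  of the squared kernel inside, where Plancherel bounds it uniformly in \<open>y\<close>.\<close>

lemma mise_le:
  assumes n: "n > 0"
  shows "(\<integral>\<^sup>+ Y. (\<integral>\<^sup>+ x. ennreal ((cmod (kernel_est (Phi feps) n (1 / a) Y x - complex_of_real (f x)))\<^sup>2) \<partial>lborel) \<partial>sample_law f feps n)
    \<le> ennreal (L * exp (- 2 * \<alpha> * a powr r) + a * K\<^sup>2 / pi / real n)"
proof -
  interpret PS: product_prob_space "\<lambda>_::nat. \<mu>" "{..<n}" ..
  interpret PP: pair_sigma_finite "PiM {..<n} (\<lambda>_. \<mu>)" "lborel :: real measure" ..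
  interpret xy: pair_sigma_finite "lborel :: real measure" \<mu> ..
  have S: "sample_law f feps n = PiM {..<n} (\<lambda>_. \<mu>)"
    by (simp add: sample_law_def \<mu>_def)
  have "(\<integral>\<^sup>+ Y. (\<integral>\<^sup>+ x. ennreal ((cmod (kernel_est (Phi feps) n (1 / a) Y x - complex_of_real (f x)))\<^sup>2) \<partial>lborel) \<partial>sample_law f feps n)
     = (\<integral>\<^sup>+ x. (\<integral>\<^sup>+ Y. ennreal ((cmod (kernel_est (Phi feps) n (1 / a) Y x - complex_of_real (f x)))\<^sup>2) \<partial>sample_law f feps n) \<partial>lborel)"
    unfolding kernel_est_eq_decon[OF a] S
    by (rule PP.Fubini'[symmetric]) measurable
  also have "\<dots> \<le> (\<integral>\<^sup>+ x. ennreal ((cmod ((LINT y|\<mu>. W x y) - complex_of_real (f x)))\<^sup>2)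
      + ennreal (1 / real n) * (\<integral>\<^sup>+ y. ennreal ((cmod (W x y))\<^sup>2) \<partial>\<mu>) \<partial>lborel)"
    by (intro nn_integral_mono mse_le n)
  also have "\<dots> = (\<integral>\<^sup>+ x. ennreal ((cmod ((LINT y|\<mu>. W x y) - complex_of_real (f x)))\<^sup>2) \<partial>lborel)
      + ennreal (1 / real n) * (\<integral>\<^sup>+ x. \<integral>\<^sup>+ y. ennreal ((cmod (W x y))\<^sup>2) \<partial>\<mu> \<partial>lborel)"
    by (subst nn_integral_add, measurable, subst nn_integral_cmult, measurable)
  also have "(\<integral>\<^sup>+ x. \<integral>\<^sup>+ y. ennreal ((cmod (W x y))\<^sup>2) \<partial>\<mu> \<partial>lborel) = (\<integral>\<^sup>+ y. \<integral>\<^sup>+ x. ennreal ((cmod (W x y))\<^sup>2) \<partial>lborel \<partial>\<mu>)"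
    by (rule xy.Fubini'[symmetric]) measurable
  also have "\<dots> \<le> (\<integral>\<^sup>+ y. ennreal (a * K\<^sup>2 / pi) \<partial>\<mu>)"
    by (intro nn_integral_mono nn_integral_norm_W_sq_le)
  also have "\<dots> = ennreal (a * K\<^sup>2 / pi)"
    by (simp add: \<mu>.emeasure_space_1)
  also have "(\<integral>\<^sup>+ x. ennreal ((cmod ((LINT y|\<mu>. W x y) - complex_of_real (f x)))\<^sup>2) \<partial>lborel) \<le> ennreal (L * exp (- 2 * \<alpha> * a powr r))"
    by (rule bias_L2)
  also have "ennreal (L * exp (- 2 * \<alpha> * a powr r)) + ennreal (1 / real n) * ennreal (a * K\<^sup>2 / pi)
      = ennreal (L * exp (- 2 * \<alpha> * a powr r) + a * K\<^sup>2 / pi / real n)"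
    using pos a by (subst ennreal_mult[symmetric]) (auto simp: ennreal_plus[symmetric] simp del: ennreal_plus)
  finally show ?thesis
    by (simp add: add_left_mono mult_left_mono)
qed

end

section \<open>Asymptotics\<close>

text \<open>The leading term of an integration by parts is -x^(1-r) exp(-2 \<alpha> x^r) / (2
  \<alpha> r). Its derivative is the integrand times 1 - (1 - r) x^(-r) / (2 \<alpha> r), a factor
  of at least 1 - \<delta> on [a, \<infinity>). Dividing by 1 - \<delta> therefore yields the
  antiderivative of a majorant, and the loss vanishes as \<open>a\<close> grows.\<close>

lemma nn_integral_exp_powr_tail_le:
  fixes \<alpha> r a :: real
  assumes pos: "\<alpha> > 0" "r > 0" "a > 0"
  defines "\<delta> \<equiv> \<bar>1 - r\<bar> * a powr (- r) / (2 * \<alpha> * r)"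
  assumes \<delta>: "\<delta> < 1"
  shows "(\<integral>\<^sup>+ v. ennreal (exp (- 2 * \<alpha> * v powr r)) * indicator {a..} v \<partial>lborel)
    \<le> ennreal (a powr (1 - r) * exp (- 2 * \<alpha> * a powr r) / (2 * \<alpha> * r) / (1 - \<delta>))"
proof -
  define c where "c = 1 / (2 * \<alpha> * r) / (1 - \<delta>)"
  define F where "F x = - (x powr (1 - r) * exp (- 2 * \<alpha> * x powr r) * c)" for x
  define F' where "F' x = exp (- 2 * \<alpha> * x powr r) * (1 - (1 - r) * x powr (- r) / (2 * \<alpha> * r)) / (1 - \<delta>)" for x
  have deriv: "(F has_real_derivative F' x) (at x)" if "a \<le> x" for x
  proof -
    have x: "x > 0" using that pos by simp
    have e: "x powr (1 - r) * x powr (r - 1) = 1" "x powr (1 - r - 1) = x powr (- r)"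
      using x by (simp_all add: powr_add[symmetric])
    have "(F has_real_derivative - (((1 - r) * x powr (1 - r - 1) * exp (- 2 * \<alpha> * x powr r)
        + exp (- 2 * \<alpha> * x powr r) * (- 2 * \<alpha> * (r * x powr (r - 1))) * x powr (1 - r)) * c)) (at x)"
      unfolding F_def using x by (auto intro!: derivative_eq_intros)
    also have "(1 - r) * x powr (1 - r - 1) * exp (- 2 * \<alpha> * x powr r)
        + exp (- 2 * \<alpha> * x powr r) * (- 2 * \<alpha> * (r * x powr (r - 1))) * x powr (1 - r)
      = exp (- 2 * \<alpha> * x powr r) * ((1 - r) * x powr (- r) - 2 * \<alpha> * r * (x powr (1 - r) * x powr (r - 1)))"
      unfolding e(2) by (simp add: algebra_simps)
    also have "- (\<dots> * c) = F' x"
      unfolding F'_def e(1) c_def using pos \<delta> by (simp add: field_simps)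
    finally show ?thesis .
  qed
  have ge: "exp (- 2 * \<alpha> * x powr r) \<le> F' x" if "a \<le> x" for x
  proof -
    have "(1 - r) * x powr (- r) \<le> \<bar>1 - r\<bar> * a powr (- r)"
      using that pos powr_mono2'[of "- r" a x] by (intro mult_mono) auto
    then have "(1 - r) * x powr (- r) / (2 * \<alpha> * r) \<le> \<delta>"
      unfolding \<delta>_def using pos by (intro divide_right_mono) auto
    then have "1 \<le> (1 - (1 - r) * x powr (- r) / (2 * \<alpha> * r)) / (1 - \<delta>)"
      using \<delta> by (simp add: pos_le_divide_eq)
    then have "exp (- 2 * \<alpha> * x powr r) * 1 \<le> exp (- 2 * \<alpha> * x powr r) * ((1 - (1 - r) * x powr (- r) / (2 * \<alpha> * r)) / (1 - \<delta>))"
      by (intro mult_left_mono) auto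
    then show ?thesis by (simp add: F'_def)
  qed
  \<comment> \<open>In the variable z = x^r the power of \<open>x\<close> becomes a power of z,
    which exponential decay in z dominates.\<close>
  have lim: "(F \<longlongrightarrow> 0) at_top"
  proof -
    have "((\<lambda>z::real. z powr ((1 - r) / r) * exp (- 2 * \<alpha> * z)) \<longlongrightarrow> 0) at_top"
      using pos by real_asymp
    moreover have "filterlim (\<lambda>x::real. x powr r) at_top at_top"
      using pos by real_asymp
    ultimately have "((\<lambda>x::real. (x powr r) powr ((1 - r) / r) * exp (- 2 * \<alpha> * x powr r)) \<longlongrightarrow> 0) at_top"
      by (rule filterlim_compose)
    then have "((\<lambda>x::real. - ((x powr r) powr ((1 - r) / r) * exp (- 2 * \<alpha> * x powr r) * c)) \<longlongrightarrow> - (0 * c)) at_top"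
      by (intro tendsto_minus tendsto_mult_right)
    then show ?thesis
      using pos by (simp add: F_def[abs_def] powr_powr)
  qed
  have "(\<integral>\<^sup>+ v. ennreal (exp (- 2 * \<alpha> * v powr r)) * indicator {a..} v \<partial>lborel)
      \<le> (\<integral>\<^sup>+ v. ennreal (F' v) * indicator {a..} v \<partial>lborel)"
    using ge by (intro nn_integral_mono) (auto simp: indicator_def ennreal_leI)
  also have "\<dots> = 0 - F a"
  proof (rule nn_integral_FTC_atLeast[OF _ deriv _ lim])
    show "F' \<in> borel_measurable borel" unfolding F'_def by measurable
    show "0 \<le> F' x" if "a \<le> x" for x using ge[OF that] order_trans[OF exp_ge_zero] by blast
  qed
  finally show ?thesis
    by (simp add: F_def c_def)
qed

lemma nn_integral_exp_powr_two_sided_tail_le: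
  fixes \<alpha> r a :: real
  assumes pos: "\<alpha> > 0" "r > 0" "a > 0"
  defines "\<delta> \<equiv> \<bar>1 - r\<bar> * a powr (- r) / (2 * \<alpha> * r)"
  assumes \<delta>: "\<delta> < 1"
  shows "(\<integral>\<^sup>+ v. ennreal (exp (- 2 * \<alpha> * \<bar>v\<bar> powr r)) * indicator (- {-a..a}) v \<partial>lborel)
    \<le> ennreal (2 * (a powr (1 - r) * exp (- 2 * \<alpha> * a powr r) / (2 * \<alpha> * r) / (1 - \<delta>)))"
proof -
  let ?h = "\<lambda>v. ennreal (exp (- 2 * \<alpha> * v powr r)) * indicator {a..} v"
  let ?I = "\<integral>\<^sup>+ v. ?h v \<partial>lborel"
  have "(\<integral>\<^sup>+ v. ennreal (exp (- 2 * \<alpha> * \<bar>v\<bar> powr r)) * indicator (- {-a..a}) v \<partial>lborel)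
      \<le> (\<integral>\<^sup>+ v. ?h v + ?h (- v) \<partial>lborel)"
  proof (rule nn_integral_mono)
    fix v
    show "ennreal (exp (- 2 * \<alpha> * \<bar>v\<bar> powr r)) * indicator (- {-a..a}) v \<le> ?h v + ?h (- v)"
      using pos(3) by (cases "v \<ge> 0") (auto simp: indicator_def)
  qed
  also have "\<dots> = ?I + (\<integral>\<^sup>+ v. ?h (- v) \<partial>lborel)"
    by (rule nn_integral_add) measurable
  also have "(\<integral>\<^sup>+ v. ?h (- v) \<partial>lborel) = ?I"
    using nn_integral_real_affine[of ?h "-1" 0] by simp
  also have "?I + ?I = 2 * ?I"
    by (rule mult_2[symmetric])
  also have "\<dots> \<le> 2 * ennreal (a powr (1 - r) * exp (- 2 * \<alpha> * a powr r) / (2 * \<alpha> * r) / (1 - \<delta>))"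
    using nn_integral_exp_powr_tail_le[OF pos] \<delta> unfolding \<delta>_def by (intro mult_left_mono) auto
  also have "\<dots> = ennreal (2 * (a powr (1 - r) * exp (- 2 * \<alpha> * a powr r) / (2 * \<alpha> * r) / (1 - \<delta>)))"
    using pos \<delta> by (subst ennreal_mult) auto
  finally show ?thesis .
qed

text \<open>On [-u0, u0] a continuous nonvanishing function is bounded away from zero by
  compactness; beyond \<open>u0\<close> the assumed lower bound is inverted. The exponent |\<gamma>|
  serves both signs of \<gamma>.\<close>

lemma inverse_Phi_bound:
  fixes feps :: "real \<Rightarrow> real" and \<beta> s u0 bmin \<gamma> :: real
  assumes "\<beta> > 0" "s > 0" and feps: "is_density feps" and "u0 > 0" "bmin > 0"
    and lower: "\<forall>u. \<bar>u\<bar> \<ge> u0 \<longrightarrow> cmod (Phi feps u) \<ge> bmin * \<bar>u\<bar> powr \<gamma> * exp (- \<beta> * \<bar>u\<bar> powr s)"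
    and nonzero: "\<forall>u. Phi feps u \<noteq> 0"
  obtains C where "C > 0"
    "\<And>a v. a \<ge> 1 \<Longrightarrow> \<bar>v\<bar> \<le> a \<Longrightarrow> 1 / cmod (Phi feps v) \<le> C * a powr \<bar>\<gamma>\<bar> * exp (\<beta> * a powr s)"
proof -
  obtain w where w: "w \<in> {-u0..u0}" "\<And>v. v \<in> {-u0..u0} \<Longrightarrow> cmod (Phi feps w) \<le> cmod (Phi feps v)"
    using continuous_attains_inf[of "{-u0..u0}" "\<lambda>v. cmod (Phi feps v)"] \<open>u0 > 0\<close>
      continuous_on_norm[OF continuous_on_Phi[OF feps]] by auto
  define c where "c = cmod (Phi feps w)"
  have c: "c > 0" using nonzero by (simp add: c_def)
  \<comment> \<open>The first summand handles \<gamma> \<ge> 0, where |v|^(-\<gamma>) is largest at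
    \<open>u0\<close>; the 1 handles \<gamma> < 0, where it is largest at \<open>a\<close>.\<close>
  define D where "D = u0 powr (- \<bar>\<gamma>\<bar>) + 1"
  have D: "D \<ge> 1" by (simp add: D_def)
  define C where "C = 1 / c + D / bmin"
  have C: "C > 0" using c D \<open>bmin > 0\<close> by (simp add: C_def add_pos_pos)
  have "1 / cmod (Phi feps v) \<le> C * a powr \<bar>\<gamma>\<bar> * exp (\<beta> * a powr s)" if a: "a \<ge> 1" and v: "\<bar>v\<bar> \<le> a" for a v
  proof -
    have ag: "1 \<le> a powr \<bar>\<gamma>\<bar>" using a by (simp add: ge_one_powr_ge_zero)
    show ?thesis
    proof (cases "\<bar>v\<bar> \<le> u0")
      case True
      then have "c \<le> cmod (Phi feps v)"
        using w(2)[of v] by (auto simp: c_def abs_le_iff)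
      then have "1 / cmod (Phi feps v) \<le> 1 / c"
        using c by (intro frac_le) auto
      also have "\<dots> \<le> C" using D \<open>bmin > 0\<close> by (simp add: C_def)
      also have "C * 1 * 1 \<le> C * a powr \<bar>\<gamma>\<bar> * exp (\<beta> * a powr s)"
        using C ag \<open>\<beta> > 0\<close> by (intro mult_mono) auto
      finally show ?thesis by simp
    next
      case False
      then have v0: "\<bar>v\<bar> \<ge> u0" "\<bar>v\<bar> > 0" using \<open>u0 > 0\<close> by auto
      have "\<bar>v\<bar> powr (- \<gamma>) \<le> D * a powr \<bar>\<gamma>\<bar>"
      proof (cases "\<gamma> \<ge> 0")
        case True
        then have "\<bar>v\<bar> powr (- \<gamma>) \<le> u0 powr (- \<gamma>)"
          using v0 \<open>u0 > 0\<close> by (intro powr_mono2') auto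
        also have "\<dots> \<le> D * 1" using True by (simp add: D_def)
        also have "\<dots> \<le> D * a powr \<bar>\<gamma>\<bar>" using D ag by (intro mult_left_mono) auto
        finally show ?thesis .
      next
        case False
        then have "\<bar>v\<bar> powr (- \<gamma>) \<le> a powr (- \<gamma>)"
          using v v0 by (intro powr_mono2) auto
        also have "\<dots> = 1 * a powr \<bar>\<gamma>\<bar>" using False by simp
        also have "\<dots> \<le> D * a powr \<bar>\<gamma>\<bar>" using D by (intro mult_right_mono) auto
        finally show ?thesis .
      qed
      moreover have "exp (\<beta> * \<bar>v\<bar> powr s) \<le> exp (\<beta> * a powr s)"
        using v \<open>\<beta> > 0\<close> \<open>s > 0\<close> by (simp add: powr_mono2)
      ultimately have "\<bar>v\<bar> powr (- \<gamma>) * exp (\<beta> * \<bar>v\<bar> powr s) \<le> (D * a powr \<bar>\<gamma>\<bar>) * exp (\<beta> * a powr s)"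
        using D by (intro mult_mono) auto
      then have "1 / bmin * (\<bar>v\<bar> powr (- \<gamma>) * exp (\<beta> * \<bar>v\<bar> powr s)) \<le> 1 / bmin * ((D * a powr \<bar>\<gamma>\<bar>) * exp (\<beta> * a powr s))"
        using \<open>bmin > 0\<close> by (intro mult_left_mono) auto
      also have "\<dots> = D / bmin * (a powr \<bar>\<gamma>\<bar> * exp (\<beta> * a powr s))"
        by simp
      also have "\<dots> \<le> C * (a powr \<bar>\<gamma>\<bar> * exp (\<beta> * a powr s))"
        using c by (intro mult_right_mono) (auto simp: C_def)
      finally have up: "1 / bmin * (\<bar>v\<bar> powr (- \<gamma>) * exp (\<beta> * \<bar>v\<bar> powr s)) \<le> C * a powr \<bar>\<gamma>\<bar> * exp (\<beta> * a powr s)"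
        by simp
      have "1 / cmod (Phi feps v) \<le> 1 / (bmin * \<bar>v\<bar> powr \<gamma> * exp (- \<beta> * \<bar>v\<bar> powr s))"
        using lower v0 \<open>bmin > 0\<close> by (intro frac_le) auto
      also have "\<dots> = 1 / bmin * (\<bar>v\<bar> powr (- \<gamma>) * exp (\<beta> * \<bar>v\<bar> powr s))"
        by (simp add: powr_minus exp_minus field_simps)
      finally show ?thesis using up by linarith
    qed
  qed
  with C show ?thesis by (rule that)
qed

text \<open>Passes from a limit of real ratios to an extended-real limsup. The premises hold only
  eventually, since a rate may vanish at small \<open>n\<close>.\<close>

lemma limsup_divide_ennreal_le:
  fixes X :: "nat \<Rightarrow> ennreal" and B \<phi> :: "nat \<Rightarrow> real"
  assumes "eventually (\<lambda>n. X n \<le> ennreal (B n)) sequentially"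
    and "eventually (\<lambda>n. 0 \<le> B n \<and> 0 < \<phi> n) sequentially"
    and lim: "(\<lambda>n. B n / \<phi> n) \<longlonglongrightarrow> l"
  shows "limsup (\<lambda>n. X n / ennreal (\<phi> n)) \<le> ennreal l"
proof -
  have "eventually (\<lambda>n. X n / ennreal (\<phi> n) \<le> ennreal (B n / \<phi> n)) sequentially"
    using assms(1,2)
  proof eventually_elim
    case (elim n)
    then have "X n / ennreal (\<phi> n) \<le> ennreal (B n) / ennreal (\<phi> n)"
      by (intro divide_right_mono_ennreal) auto
    with elim show ?case by (simp add: divide_ennreal)
  qed
  then have "limsup (\<lambda>n. X n / ennreal (\<phi> n)) \<le> limsup (\<lambda>n. ennreal (B n / \<phi> n))"
    by (rule Limsup_mono)
  also have "\<dots> = ennreal l"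
    by (intro lim_imp_Limsup tendsto_ennrealI lim) simp
  finally show ?thesis .
qed

text \<open>Limits in a continuous variable \<open>t\<close>, into which
  \<open>sqrt (ln n / (2 * \<beta>))\<close> is later substituted; \<open>Q t\<close> is then the
  s-th power of the inverse bandwidth.\<close>

lemma bandwidth_power_limits:
  fixes \<alpha> \<beta> A p q c d :: real
  assumes "\<beta> > 0"
  defines "Q \<equiv> \<lambda>t. t\<^sup>2 - A / \<beta> * t"
  shows "((\<lambda>t. (Q t / t\<^sup>2) powr q) \<longlongrightarrow> 1) at_top"
    and "((\<lambda>t. exp (- 2 * \<alpha> * sqrt (Q t) + 2 * \<alpha> * t - \<alpha>\<^sup>2 / \<beta>)) \<longlongrightarrow> exp (\<alpha> * A / \<beta> - \<alpha>\<^sup>2 / \<beta>)) at_top"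
    and "((\<lambda>t. c * Q t powr (- 1 / 2)) \<longlongrightarrow> 0) at_top"
    and "d > 0 \<Longrightarrow> ((\<lambda>t. Q t powr p * (t\<^sup>2) powr q * exp (- d * t)) \<longlongrightarrow> 0) at_top"
    and "filterlim Q at_top at_top"
proof -
  define B where "B = A / \<beta>"
  show "((\<lambda>t. (Q t / t\<^sup>2) powr q) \<longlongrightarrow> 1) at_top"
    unfolding Q_def B_def[symmetric] by real_asymp
  \<comment> \<open>The source of the constant: the first-order correction -B / 2, multiplied by -2
    \<alpha>, becomes \<alpha> A / \<beta>.\<close>
  have "((\<lambda>t::real. sqrt (t\<^sup>2 - B * t) - t) \<longlongrightarrow> - B / 2) at_top"
    by real_asymp
  then have "((\<lambda>t. exp (- 2 * \<alpha> * (sqrt (Q t) - t) - \<alpha>\<^sup>2 / \<beta>)) \<longlongrightarrow> exp (- 2 * \<alpha> * (- B / 2) - \<alpha>\<^sup>2 / \<beta>)) at_top"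
    unfolding Q_def B_def[symmetric] by (intro tendsto_intros)
  then show "((\<lambda>t. exp (- 2 * \<alpha> * sqrt (Q t) + 2 * \<alpha> * t - \<alpha>\<^sup>2 / \<beta>)) \<longlongrightarrow> exp (\<alpha> * A / \<beta> - \<alpha>\<^sup>2 / \<beta>)) at_top"
    by (simp add: B_def algebra_simps)
  show "((\<lambda>t. c * Q t powr (- 1 / 2)) \<longlongrightarrow> 0) at_top"
    unfolding Q_def B_def[symmetric] by real_asymp
  show "((\<lambda>t. Q t powr p * (t\<^sup>2) powr q * exp (- d * t)) \<longlongrightarrow> 0) at_top" if "d > 0"
    unfolding Q_def B_def[symmetric] using that by real_asymp
  show "filterlim Q at_top at_top"
    unfolding Q_def B_def[symmetric] by real_asymp
qed

theorem theorem3: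
  fixes feps :: "real \<Rightarrow> real"
    and \<beta> s u0 bmin \<gamma> \<alpha>0 A \<alpha> L :: real
  assumes "\<beta> > 0" and "s > 0"
    and "is_density feps"
    and "u0 > 0" and "bmin > 0"
    and "\<forall>u. \<bar>u\<bar> \<ge> u0 \<longrightarrow> cmod (Phi feps u) \<ge> bmin * \<bar>u\<bar> powr \<gamma> * exp (- \<beta> * \<bar>u\<bar> powr s)"
    and "\<forall>u. Phi feps u \<noteq> 0"
    and "\<alpha>0 > 0" and "A > \<alpha>0"
    and "0 < \<alpha>" and "\<alpha> \<le> \<alpha>0" and "L > 0"
  shows "limsup (\<lambda>n. (SUP x. risk_pt feps (h_a \<beta> s A) (A_class \<alpha> (s / 2) L) n x)
             / ennreal (phi2 \<alpha> (s / 2) L \<beta> s n))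
           \<le> ennreal (exp (\<alpha> * A / \<beta> - \<alpha>\<^sup>2 / \<beta>))
         \<and> limsup (\<lambda>n. risk_L2 feps (h_a \<beta> s A) (A_class \<alpha> (s / 2) L) n
             / ennreal (phi2_L2 \<alpha> L \<beta> n))
           \<le> ennreal (exp (\<alpha> * A / \<beta> - \<alpha>\<^sup>2 / \<beta>))"
proof -
  obtain C where C: "C > 0"
    "\<And>a v. a \<ge> 1 \<Longrightarrow> \<bar>v\<bar> \<le> a \<Longrightarrow> 1 / cmod (Phi feps v) \<le> C * a powr \<bar>\<gamma>\<bar> * exp (\<beta> * a powr s)"
    using inverse_Phi_bound[OF assms(1-7)] by blast
  define r where "r = s / 2"
  have r: "r > 0" using \<open>s > 0\<close> by (simp add: r_def)
  define T where "T n = sqrt (ln (real n) / (2 * \<beta>))" for n :: nat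
  define Q where "Q t = t\<^sup>2 - A / \<beta> * t" for t
  define a where "a n = Q (T n) powr (1 / s)" for n
  define K where "K n = C * a n powr \<bar>\<gamma>\<bar> * exp (\<beta> * a n powr s)" for n
  define \<delta> where "\<delta> n = \<bar>1 - r\<bar> * a n powr (- r) / (2 * \<alpha> * r)" for n
  define J where "J n = 2 * (a n powr (1 - r) * exp (- 2 * \<alpha> * a n powr r) / (2 * \<alpha> * r) / (1 - \<delta> n))" for n
  define q where "q = (1 - r) / s"
  define E where "E t = exp (- 2 * \<alpha> * sqrt (Q t) + 2 * \<alpha> * t - \<alpha>\<^sup>2 / \<beta>)" for t
  note lims = bandwidth_power_limits[where A=A, OF \<open>\<beta> > 0\<close>, folded Q_def]

  have T_top: "filterlim T at_top sequentially"
    unfolding T_def using \<open>\<beta> > 0\<close> by real_asymp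
  have Q_top: "filterlim (\<lambda>n. Q (T n)) at_top sequentially"
    by (rule filterlim_compose[OF lims(5) T_top])
  have a_top: "filterlim a at_top sequentially"
  proof -
    have "filterlim (\<lambda>x::real. x powr (1 / s)) at_top at_top"
      using \<open>s > 0\<close> by real_asymp
    from filterlim_compose[OF this Q_top] show ?thesis
      by (simp add: a_def[abs_def])
  qed
  have a_powr: "a n powr z = Q (T n) powr (z / s)" for n z
    by (simp add: a_def powr_powr)
  \<comment> \<open>Here r / s = 1 / 2.\<close>
  have \<delta>_eq: "\<delta> n = \<bar>1 - r\<bar> / (2 * \<alpha> * r) * Q (T n) powr (- 1 / 2)" for n
    using \<open>s > 0\<close> by (simp add: \<delta>_def a_powr r_def)
  have \<delta>_lim: "\<delta> \<longlonglongrightarrow> 0"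
    unfolding \<delta>_eq[abs_def] by (rule filterlim_compose[OF lims(3) T_top])
  have ev: "eventually (\<lambda>n. n > 0 \<and> T n > 0 \<and> Q (T n) > 0 \<and> a n \<ge> 1 \<and> \<delta> n < 1) sequentially"
    using eventually_gt_at_top[of 0] filterlim_at_top_dense[THEN iffD1, OF T_top, rule_format, of 0]
      filterlim_at_top_dense[THEN iffD1, OF Q_top, rule_format, of 0]
      filterlim_at_top[THEN iffD1, OF a_top, rule_format, of 1] order_tendstoD(2)[OF \<delta>_lim, of 1]
    by (intro eventually_conj) auto
  have h: "h_a \<beta> s A n = 1 / a n" if "T n > 0" for n
  proof -
    \<comment> \<open>Positivity of \<open>T n\<close> forces the argument of the square root to be
      positive, so squaring recovers it.\<close>
    have "ln (real n) / (2 * \<beta>) = (T n)\<^sup>2"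
      using that by (auto simp: T_def)
    then show ?thesis
      unfolding h_a_def a_def Q_def T_def[symmetric] by (simp add: powr_minus_divide)
  qed

  have target: "deconvolution_target feps (a n) (K n) f \<alpha> r L (J n)"
    if "a n \<ge> 1" "\<delta> n < 1" "f \<in> A_class \<alpha> r L" for n f
  proof
    show "(\<integral>\<^sup>+ v. ennreal (exp (- 2 * \<alpha> * \<bar>v\<bar> powr r)) * indicator (- {- a n..a n}) v \<partial>lborel) \<le> ennreal (J n)"
      unfolding J_def using that r \<open>\<alpha> > 0\<close> unfolding \<delta>_def
      by (intro nn_integral_exp_powr_two_sided_tail_le) auto
    show "J n > 0"
      using that r \<open>\<alpha> > 0\<close> by (simp add: J_def)
    show "1 / cmod (Phi feps v) \<le> K n" if "\<bar>v\<bar> \<le> a n" for v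
      unfolding K_def using C(2) \<open>a n \<ge> 1\<close> that by blast
  qed (use assms r that in auto)

  \<comment> \<open>Both bounds are free of \<open>f\<close> and \<open>x\<close>, so they survive
    the suprema in the risks.\<close>
  define Bp where "Bp n = L * J n / (2 * pi) + (a n * K n / pi)\<^sup>2 / real n" for n
  define B2 where "B2 n = L * exp (- 2 * \<alpha> * a n powr r) + a n * (K n)\<^sup>2 / pi / real n" for n
  have risk_p: "eventually (\<lambda>n. (SUP x. risk_pt feps (h_a \<beta> s A) (A_class \<alpha> r L) n x) \<le> ennreal (Bp n)) sequentially"
    using ev
  proof eventually_elim
    case (elim n)
    show ?case
      unfolding risk_pt_def Bp_def
    proof (intro SUP_least)
      fix x f assume "f \<in> A_class \<alpha> r L"
      then interpret deconvolution_target feps "a n" "K n" f \<alpha> r L "J n"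
        using target elim by blast
      show "(\<integral>\<^sup>+ Y. ennreal ((cmod (kernel_est (Phi feps) n (h_a \<beta> s A n) Y x - complex_of_real (f x)))\<^sup>2) \<partial>sample_law f feps n)
          \<le> ennreal (L * J n / (2 * pi) + (a n * K n / pi)\<^sup>2 / real n)"
        using mse_pointwise_le[of n x] elim by (simp add: h)
    qed
  qed
  have risk_2: "eventually (\<lambda>n. risk_L2 feps (h_a \<beta> s A) (A_class \<alpha> r L) n \<le> ennreal (B2 n)) sequentially"
    using ev
  proof eventually_elim
    case (elim n)
    show ?case
      unfolding risk_L2_def B2_def
    proof (intro SUP_least)
      fix f assume "f \<in> A_class \<alpha> r L"
      then interpret deconvolution_target feps "a n" "K n" f \<alpha> r L "J n"
        using target elim by blast
      show "(\<integral>\<^sup>+ Y. (\<integral>\<^sup>+ x. ennreal ((cmod (kernel_est (Phi feps) n (h_a \<beta> s A n) Y x - complex_of_real (f x)))\<^sup>2) \<partial>lborel) \<partial>sample_law f feps n)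
          \<le> ennreal (L * exp (- 2 * \<alpha> * a n powr r) + a n * (K n)\<^sup>2 / pi / real n)"
        using mise_le[of n] elim by (simp add: h)
    qed
  qed

  have exp_cancel: "(exp (\<beta> * a n powr s))\<^sup>2 / real n = exp (- 2 * A * T n)" if "n > 0" "T n > 0" "Q (T n) > 0" for n
  proof -
    have "ln (real n) = 2 * \<beta> * (T n)\<^sup>2"
      using that \<open>\<beta> > 0\<close> by (auto simp: T_def)
    then have n: "real n = exp (2 * \<beta> * (T n)\<^sup>2)"
      using that(1) by (metis exp_ln of_nat_0_less_iff)
    have "a n powr s = (T n)\<^sup>2 - A / \<beta> * T n"
      using that \<open>s > 0\<close> by (simp add: a_powr) (simp add: Q_def)
    then have "\<beta> * a n powr s = \<beta> * (T n)\<^sup>2 - A * T n"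
      using \<open>\<beta> > 0\<close> by (simp add: right_diff_distrib)
    then have "2 * (\<beta> * a n powr s) - 2 * \<beta> * (T n)\<^sup>2 = - 2 * A * T n"
      by simp
    then show ?thesis
      by (subst n) (simp add: exp_double[symmetric] exp_diff[symmetric])
  qed
  \<comment> \<open>\<open>E\<close> is exactly the bias exponential divided by the exponential of
    the rate; its limit is the claimed constant.\<close>
  have bias_factor: "exp (- 2 * \<alpha> * a n powr r) / exp (- 2 * \<alpha> * T n + \<alpha>\<^sup>2 / \<beta>) = E (T n)" if "Q (T n) > 0" for n
  proof -
    have "a n powr r = sqrt (Q (T n))"
      using that \<open>s > 0\<close> by (simp add: a_powr r_def powr_half_sqrt)
    then show ?thesis
      by (simp add: E_def exp_diff[symmetric])
  qed
  have noise_factor: "exp (- 2 * A * T n) / exp (- 2 * \<alpha> * T n + \<alpha>\<^sup>2 / \<beta>) = exp (- (\<alpha>\<^sup>2 / \<beta>)) * exp (- (2 * (A - \<alpha>)) * T n)" for n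
    by (simp add: exp_diff[symmetric] exp_add[symmetric] algebra_simps)
  have gap: "2 * (A - \<alpha>) > 0" using assms by simp
  have E_lim: "(\<lambda>n. E (T n)) \<longlonglongrightarrow> exp (\<alpha> * A / \<beta> - \<alpha>\<^sup>2 / \<beta>)"
    unfolding E_def by (rule filterlim_compose[OF lims(2) T_top])
  have noise_lim: "(\<lambda>n. c * (Q (T n) powr p * ((T n)\<^sup>2) powr z * exp (- (2 * (A - \<alpha>)) * T n))) \<longlonglongrightarrow> 0" for c p z
    using tendsto_mult_right_zero[OF filterlim_compose[OF lims(4)[OF gap] T_top]] .

  \<comment> \<open>The product \<open>a n * K n\<close> carries the power 1 + |\<gamma>| of
    \<open>a n\<close>; squared and expressed through \<open>Q (T n)\<close>, the exponent is
    \<open>2 * k / s\<close>.\<close>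
  define k where "k = 1 + \<bar>\<gamma>\<bar>"
  define cp where "cp = (C / pi)\<^sup>2 * exp (- (\<alpha>\<^sup>2 / \<beta>)) / (L / (2 * pi * \<alpha> * r))"
  \<comment> \<open>The first summand is the bias, whose factors apart from \<open>E\<close> tend to
    1; the second is the variance, killed by the exponential.\<close>
  have ratio_p: "Bp n / phi2 \<alpha> r L \<beta> s n
      = (Q (T n) / (T n)\<^sup>2) powr q * E (T n) / (1 - \<delta> n)
        + cp * (Q (T n) powr (2 * k / s) * ((T n)\<^sup>2) powr (- q) * exp (- (2 * (A - \<alpha>)) * T n))"
    if n: "n > 0" "T n > 0" "Q (T n) > 0" "a n \<ge> 1" "\<delta> n < 1" for n
  proof -
    have T2: "ln (real n) / (2 * \<beta>) = (T n)\<^sup>2"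
      using n by (auto simp: T_def)
    let ?e = "exp (- 2 * \<alpha> * T n + \<alpha>\<^sup>2 / \<beta>)"
    define P where "P = L / (2 * pi * \<alpha> * r)"
    have P: "P > 0" using assms r by (simp add: P_def)
    have phi: "phi2 \<alpha> r L \<beta> s n = P * ((T n)\<^sup>2) powr q * ?e"
      using n unfolding phi2_def P_def q_def T2 by simp
    \<comment> \<open>The 2 from the two-sided tail cancels the 2 in the bias factor L / (2 pi), and
      the 1 / (2 \<alpha> r) of the tail bound completes exactly the prefactor of the rate.\<close>
    have "L * J n / (2 * pi) = P * a n powr (1 - r) * exp (- 2 * \<alpha> * a n powr r) / (1 - \<delta> n)"
    proof -
      have "L * (2 * (X / (2 * \<alpha> * r) / D)) / (2 * pi) = P * X / D" for X D
        by (simp add: P_def mult_ac)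
      then show ?thesis by (simp add: J_def mult.assoc)
    qed
    then have "L * J n / (2 * pi) / phi2 \<alpha> r L \<beta> s n
        = (a n powr (1 - r) / ((T n)\<^sup>2) powr q) * (exp (- 2 * \<alpha> * a n powr r) / ?e) / (1 - \<delta> n)"
      using P n unfolding phi by simp
    also have "\<dots> = (Q (T n) / (T n)\<^sup>2) powr q * E (T n) / (1 - \<delta> n)"
      using n by (simp only: bias_factor) (simp add: a_powr q_def powr_divide)
    finally have 1: "L * J n / (2 * pi) / phi2 \<alpha> r L \<beta> s n = (Q (T n) / (T n)\<^sup>2) powr q * E (T n) / (1 - \<delta> n)" .
    have "a n * a n powr \<bar>\<gamma>\<bar> = a n powr k"
      using n by (simp add: k_def powr_add)
    moreover have "a n * K n = C * (a n * a n powr \<bar>\<gamma>\<bar>) * exp (\<beta> * a n powr s)"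
      by (simp add: K_def)
    ultimately have "(a n * K n / pi)\<^sup>2 / real n = (C / pi)\<^sup>2 * (a n powr k)\<^sup>2 * ((exp (\<beta> * a n powr s))\<^sup>2 / real n)"
      by (simp add: power_divide power_mult_distrib)
    also have "(a n powr k)\<^sup>2 = Q (T n) powr (2 * k / s)"
      by (simp add: a_powr power2_eq_square powr_add[symmetric])
    also note exp_cancel[OF n(1-3)]
    finally have "(a n * K n / pi)\<^sup>2 / real n / phi2 \<alpha> r L \<beta> s n
       = (C / pi)\<^sup>2 / P * (Q (T n) powr (2 * k / s) / ((T n)\<^sup>2) powr q * (exp (- 2 * A * T n) / ?e))"
      unfolding phi by simp
    also have "\<dots> = cp * (Q (T n) powr (2 * k / s) * ((T n)\<^sup>2) powr (- q) * exp (- (2 * (A - \<alpha>)) * T n))"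
      unfolding noise_factor cp_def P_def[symmetric] by (simp add: powr_minus_divide)
    finally show ?thesis
      unfolding Bp_def add_divide_distrib using 1 by simp
  qed
  have lim_p: "(\<lambda>n. Bp n / phi2 \<alpha> r L \<beta> s n) \<longlonglongrightarrow> exp (\<alpha> * A / \<beta> - \<alpha>\<^sup>2 / \<beta>)"
  proof -
    have "(\<lambda>n. (Q (T n) / (T n)\<^sup>2) powr q * E (T n) / (1 - \<delta> n)
        + cp * (Q (T n) powr (2 * k / s) * ((T n)\<^sup>2) powr (- q) * exp (- (2 * (A - \<alpha>)) * T n)))
      \<longlonglongrightarrow> 1 * exp (\<alpha> * A / \<beta> - \<alpha>\<^sup>2 / \<beta>) / (1 - 0) + 0"
      by (intro tendsto_add tendsto_divide tendsto_mult tendsto_diff tendsto_const E_lim \<delta>_lim noise_lim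
          filterlim_compose[OF lims(1) T_top]) simp
    moreover have "eventually (\<lambda>n. (Q (T n) / (T n)\<^sup>2) powr q * E (T n) / (1 - \<delta> n)
        + cp * (Q (T n) powr (2 * k / s) * ((T n)\<^sup>2) powr (- q) * exp (- (2 * (A - \<alpha>)) * T n))
        = Bp n / phi2 \<alpha> r L \<beta> s n) sequentially"
      using ev by eventually_elim (simp only: ratio_p)
    ultimately show ?thesis
      using Lim_transform_eventually by simp
  qed

  define c2 where "c2 = C\<^sup>2 / pi * exp (- (\<alpha>\<^sup>2 / \<beta>)) / L"
  \<comment> \<open>In the integrated variance \<open>a n\<close> enters once and \<open>K n\<close>
    twice.\<close>
  define k2 where "k2 = 1 + 2 * \<bar>\<gamma>\<bar>"
  \<comment> \<open>The factor \<open>((T n)\<^sup>2) powr 0\<close> equals 1 because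
    \<open>T n\<close> is positive; it puts the term in the shape of
    \<open>noise_lim\<close>.\<close>
  have ratio_2: "B2 n / phi2_L2 \<alpha> L \<beta> n
      = E (T n) + c2 * (Q (T n) powr (k2 / s) * ((T n)\<^sup>2) powr 0 * exp (- (2 * (A - \<alpha>)) * T n))"
    if n: "n > 0" "T n > 0" "Q (T n) > 0" "a n \<ge> 1" "\<delta> n < 1" for n
  proof -
    let ?e = "exp (- 2 * \<alpha> * T n + \<alpha>\<^sup>2 / \<beta>)"
    have phi: "phi2_L2 \<alpha> L \<beta> n = L * ?e"
      unfolding phi2_L2_def T_def[symmetric] ..
    have 1: "L * exp (- 2 * \<alpha> * a n powr r) / phi2_L2 \<alpha> L \<beta> n = E (T n)"
      using \<open>L > 0\<close> unfolding phi by (simp flip: bias_factor[OF n(3)])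
    have "a n * (a n powr \<bar>\<gamma>\<bar>)\<^sup>2 = a n powr k2"
      using n unfolding k2_def mult_2 powr_add power2_eq_square by simp
    moreover have "a n * (K n)\<^sup>2 = C\<^sup>2 * (a n * (a n powr \<bar>\<gamma>\<bar>)\<^sup>2) * (exp (\<beta> * a n powr s))\<^sup>2"
      by (simp add: K_def power_mult_distrib)
    ultimately have "a n * (K n)\<^sup>2 / pi / real n = C\<^sup>2 / pi * a n powr k2 * ((exp (\<beta> * a n powr s))\<^sup>2 / real n)"
      by simp
    also note exp_cancel[OF n(1-3)]
    finally have "a n * (K n)\<^sup>2 / pi / real n / phi2_L2 \<alpha> L \<beta> n
       = C\<^sup>2 / pi / L * (Q (T n) powr (k2 / s) * (exp (- 2 * A * T n) / ?e))"
      unfolding phi by (simp add: a_powr)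
    also have "\<dots> = c2 * (Q (T n) powr (k2 / s) * ((T n)\<^sup>2) powr 0 * exp (- (2 * (A - \<alpha>)) * T n))"
      unfolding noise_factor c2_def using n by simp
    finally show ?thesis
      unfolding B2_def add_divide_distrib using 1 by simp
  qed
  have lim_2: "(\<lambda>n. B2 n / phi2_L2 \<alpha> L \<beta> n) \<longlonglongrightarrow> exp (\<alpha> * A / \<beta> - \<alpha>\<^sup>2 / \<beta>)"
  proof -
    have "(\<lambda>n. E (T n) + c2 * (Q (T n) powr (k2 / s) * ((T n)\<^sup>2) powr 0 * exp (- (2 * (A - \<alpha>)) * T n)))
      \<longlonglongrightarrow> exp (\<alpha> * A / \<beta> - \<alpha>\<^sup>2 / \<beta>) + 0"
      by (intro tendsto_add E_lim noise_lim)
    moreover have "eventually (\<lambda>n. E (T n) + c2 * (Q (T n) powr (k2 / s) * ((T n)\<^sup>2) powr 0 * exp (- (2 * (A - \<alpha>)) * T n))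
        = B2 n / phi2_L2 \<alpha> L \<beta> n) sequentially"
      using ev by eventually_elim (simp only: ratio_2)
    ultimately show ?thesis
      using Lim_transform_eventually by simp
  qed

  have pos_p: "eventually (\<lambda>n. 0 \<le> Bp n \<and> 0 < phi2 \<alpha> r L \<beta> s n) sequentially"
    using ev
  proof eventually_elim
    case (elim n)
    then have "ln (real n) / (2 * \<beta>) > 0"
      by (simp only: T_def real_sqrt_gt_0_iff)
    then have "0 < (ln (real n) / (2 * \<beta>)) powr ((1 - r) / s)"
      by (metis powr_gt_zero less_irrefl)
    then have "0 < phi2 \<alpha> r L \<beta> s n"
      unfolding phi2_def using assms r by (intro mult_pos_pos divide_pos_pos) auto
    then show ?case
      using elim assms r by (simp add: Bp_def J_def)
  qed
  have pos_2: "eventually (\<lambda>n. 0 \<le> B2 n \<and> 0 < phi2_L2 \<alpha> L \<beta> n) sequentially"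
    using ev
  proof eventually_elim
    case (elim n)
    then show ?case
      using assms by (simp add: B2_def phi2_L2_def)
  qed
  show ?thesis
    using limsup_divide_ennreal_le[OF risk_p pos_p lim_p] limsup_divide_ennreal_le[OF risk_2 pos_2 lim_2]
    unfolding r_def by blast
qed

end
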